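(* Let $X$ be a curve over $\mathbf{F}_{q^\ell}$ ($\ell\ge 1$), let $P_1,\dots,P_n$ be distinct $\mathbf{F}_{q^\ell}$-rational points of $X$, set $D:=P_1+\cdots+P_n$, and let $G$ be a divisor on $X$ whose support avoids $P_1,\dots,P_n$. Let $G_1$ be a divisor on $X$ such that $G\ge qG_1$ and $G\ge G_1$. Then $$\dim_{\mathbf{F}_q}\bigl(C_\Omega(D,G)_{|\mathbf{F}_q}\,/\,Car_q(D,G)\bigr)\le \ell\,h^1(G_1).$$ In particular, if $h^1(G_1)=0$ then $C_\Omega(D,G)_{|\mathbf{F}_q}=Car_q(D,G)$.
   Context: Let $p$ be a prime, $q$ a power of $p$, and $\ell\ge 1$ an integer. A curve is smooth, projective and geometrically irreducible. For a curve $X$ over $\mathbf{F}_{q^\ell}$, $F$ is its function field and $\Omega_{F/\mathbf{F}_{q^\ell}}$ its space of rational differential forms. For a divisor $A$ on $X$, $\Omega(A):=H^0(X,\Omega_X\otimes\mathcal{O}_X(-A))=\{\omega\in\Omega_{F/\mathbf{F}_{q^\ell}} : v_P(\omega)\ge v_P(A)\text{ for all places }P\}$ (with $v_P(0)=+\infty$), and $h^1(A):=\dim_{\mathbf{F}_{q^\ell}}\Omega(A)$. The AG code is $C_\Omega(D,G):=\{(\mathrm{res}_{P_1}(\omega),\dots,\mathrm{res}_{P_n}(\omega)):\omega\in\Omega(G-D)\}\subseteq\mathbf{F}_{q^\ell}^n$. For a code $C\subseteq\mathbf{F}_{q^\ell}^n$, its subfield subcode is $C_{|\mathbf{F}_q}:=C\cap\mathbf{F}_q^n$.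 Cartier operator: let $x$ be a separating element of $F/\mathbf{F}_{q^\ell}$. Each $\omega\in\Omega_{F/\mathbf{F}_{q^\ell}}$ can be written $\omega=(f_0^p+f_1^px+\cdots+f_{p-1}^px^{p-1})\,dx$ with $f_i\in F$, and $\mathcal{C}(\omega):=f_{p-1}\,dx$ (independent of the choice of $x$). If $q=p^m$, then $\mathcal{C}_q:=\mathcal{C}^m$ (the $m$-fold iterate), an $\mathbf{F}_q$-linear map satisfying $\mathrm{res}_P(\mathcal{C}_q(\omega))=\mathrm{res}_P(\omega)^{1/q}$. Let $\Omega(G-D)^{\mathcal{C}_q}:=\{\omega\in\Omega(G-D):\mathcal{C}_q(\omega)=\omega\}$. The Cartier code is the $\mathbf{F}_q$-linear code $$Car_q(D,G):=\{(\mathrm{res}_{P_1}(\omega),\dots,\mathrm{res}_{P_n}(\omega)) : \omega\in\Omega(G-D)^{\mathcal{C}_q}\}\subseteq\mathbf{F}_q^n,$$ which is a subcode of $C_\Omega(D,G)_{|\mathbf{F}_q}$. *)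

theory Defs
  imports
    "HOL-Analysis.Analysis"
    "HOL-Computational_Algebra.Polynomial"
    "HOL-Computational_Algebra.Primes"
    "HOL-Library.Poly_Mapping"
begin

section \<open>Dimension of a quotient space\<close>

text \<open>
  The scalars form a subfield \<open>k\<close> of a field type, a situation outside the locale
  \<^locale>\<open>vector_space\<close>.  The set \<open>B\<close> below is a set of representatives, one for each
  element, of a \<open>k\<close>-basis of \<open>V/W\<close>: distinct elements of \<open>B\<close> are automatically
  incongruent modulo \<open>W\<close>.  The dimension is \<open>\<infinity>\<close> when there is no finite basis
  (infimum of the empty set).
\<close>

definition basis_mod ::
    "'a::field set \<Rightarrow> ('a \<Rightarrow> 'v \<Rightarrow> 'v) \<Rightarrow> 'v::ab_group_add set \<Rightarrow> 'v set \<Rightarrow> 'v set \<Rightarrow> bool" where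
  "basis_mod k s V W B \<longleftrightarrow>
     finite B \<and> B \<subseteq> V \<and>
     (\<forall>c. (\<forall>b\<in>B. c b \<in> k) \<and> (\<Sum>b\<in>B. s (c b) b) \<in> W \<longrightarrow> (\<forall>b\<in>B. c b = 0)) \<and>
     (\<forall>v\<in>V. \<exists>c. (\<forall>b\<in>B. c b \<in> k) \<and> v - (\<Sum>b\<in>B. s (c b) b) \<in> W)"

definition quotient_dim ::
    "'a::field set \<Rightarrow> ('a \<Rightarrow> 'v \<Rightarrow> 'v) \<Rightarrow> 'v::ab_group_add set \<Rightarrow> 'v set \<Rightarrow> enat" where
  "quotient_dim k s V W = Inf {enat (card B) | B. basis_mod k s V W B}"


section \<open>Function fields of curves\<close>

definition is_subfield :: "'a::field set \<Rightarrow> bool" where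
  "is_subfield K \<longleftrightarrow> 0 \<in> K \<and> 1 \<in> K \<and>
     (\<forall>x\<in>K. \<forall>y\<in>K. x + y \<in> K \<and> x * y \<in> K) \<and> (\<forall>x\<in>K. - x \<in> K \<and> inverse x \<in> K)"

definition polys_over :: "'a::field set \<Rightarrow> 'a poly set" where
  "polys_over K = {f. \<forall>i. coeff f i \<in> K}"

definition algebraic_over :: "'a::field set \<Rightarrow> 'a \<Rightarrow> bool" where
  "algebraic_over K y \<longleftrightarrow> (\<exists>f\<in>polys_over K. f \<noteq> 0 \<and> poly f y = 0)"

definition separable_over :: "'a::field set \<Rightarrow> 'a \<Rightarrow> bool" where
  "separable_over K y \<longleftrightarrow> (\<exists>f\<in>polys_over K. coprime f (pderiv f) \<and> poly f y = 0)"

definition adjoin :: "'a::field set \<Rightarrow> 'a \<Rightarrow> 'a set" where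
  "adjoin K x = {poly f x / poly g x | f g. f \<in> polys_over K \<and> g \<in> polys_over K \<and> poly g x \<noteq> 0}"

text \<open>
  The whole type is the function field \<open>F\<close> of the curve, \<open>K\<close> is the field of constants.
  Smooth projective geometrically irreducible curves over a perfect field \<open>K\<close> correspond to
  function fields \<open>F/K\<close> in one variable in which \<open>K\<close> is algebraically closed; the last
  condition is geometric irreducibility.
\<close>

definition curve_function_field :: "'a::field set \<Rightarrow> bool" where
  "curve_function_field K \<longleftrightarrow>
     is_subfield K \<and>
     (\<exists>x. \<not> algebraic_over K x \<and>
        (\<exists>B. finite B \<and> (\<forall>y. \<exists>c. (\<forall>b\<in>B. c b \<in> adjoin K x) \<and> y = (\<Sum>b\<in>B. c b * b)))) \<and>
     (\<forall>y. algebraic_over K y \<longrightarrow> y \<in> K)"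

definition separating :: "'a::field set \<Rightarrow> 'a \<Rightarrow> bool" where
  "separating K x \<longleftrightarrow> (\<forall>y. separable_over (adjoin K x) y)"


section \<open>Places and divisors\<close>

text \<open>
  A place (closed point of the curve) is given by its normalized discrete valuation.  The value
  at \<open>0\<close>, which should be \<open>\<infinity>\<close>, is the dummy \<open>0\<close>; hence \<open>v x \<ge> n\<close> is always written
  \<open>x = 0 \<or> v x \<ge> n\<close>.
\<close>

definition places :: "'a::field set \<Rightarrow> ('a \<Rightarrow> int) set" where
  "places K = {v. v 0 = 0 \<and>
     (\<forall>x y. x \<noteq> 0 \<and> y \<noteq> 0 \<longrightarrow> v (x * y) = v x + v y) \<and>
     (\<forall>x y. x \<noteq> 0 \<and> y \<noteq> 0 \<and> x + y \<noteq> 0 \<longrightarrow> min (v x) (v y) \<le> v (x + y)) \<and>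
     (\<forall>c\<in>K. v c = 0) \<and>
     (\<exists>t. v t = 1)}"

text \<open>Rational places: the residue field is \<open>K\<close>.\<close>

definition rational_places :: "'a::field set \<Rightarrow> ('a \<Rightarrow> int) set" where
  "rational_places K =
     {v \<in> places K. \<forall>f. 0 \<le> v f \<longrightarrow> (\<exists>c\<in>K. f - c = 0 \<or> 0 < v (f - c))}"

text \<open>Divisors are ordered pointwise, by the order on functions.\<close>

type_synonym 'a divisor = "('a \<Rightarrow> int) \<Rightarrow> int"

definition is_divisor :: "'a::field set \<Rightarrow> 'a divisor \<Rightarrow> bool" where
  "is_divisor K A \<longleftrightarrow> finite {v. A v \<noteq> 0} \<and> {v. A v \<noteq> 0} \<subseteq> places K"

definition sum_of_points :: "('n::finite \<Rightarrow> 'a \<Rightarrow> int) \<Rightarrow> 'a divisor" where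
  "sum_of_points P = (\<lambda>v. \<Sum>i\<in>UNIV. if P i = v then 1 else 0)"


section \<open>Rational differential forms\<close>

text \<open>
  The module of Kaehler differentials of \<open>F/K\<close>: the \<open>F\<close>-vector space of formal sums
  \<open>\<Sum> f dy\<close> (where \<^term>\<open>Poly_Mapping.single y f\<close> stands for \<open>f dy\<close>) modulo the relations
  of a \<open>K\<close>-derivation.  Its elements are cosets of \<open>kaehler_relations K\<close>.
\<close>

definition formal_scale :: "'a::field \<Rightarrow> ('a \<Rightarrow>\<^sub>0 'a) \<Rightarrow> ('a \<Rightarrow>\<^sub>0 'a)" where
  "formal_scale c g = Poly_Mapping.map ((*) c) g"

lemma lookup_formal_scale [simp]:
  "Poly_Mapping.lookup (formal_scale c g) y = c * Poly_Mapping.lookup g y"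
  unfolding formal_scale_def by transfer (simp add: when_def)

lemma vector_space_formal_scale: "vector_space formal_scale"
  unfolding vector_space_def
  by (intro conjI allI; rule poly_mapping_eqI;
      simp only: lookup_formal_scale Poly_Mapping.lookup_add;
      simp add: distrib_left distrib_right mult.assoc)

global_interpretation formal: vector_space formal_scale
  defines formal_span = formal.span
  by (rule vector_space_formal_scale)

definition kaehler_relations :: "'a::field set \<Rightarrow> ('a \<Rightarrow>\<^sub>0 'a) set" where
  "kaehler_relations K = formal_span (
     {Poly_Mapping.single (y + z) 1 - Poly_Mapping.single y 1 - Poly_Mapping.single z 1 | y z. True} \<union>
     {Poly_Mapping.single (y * z) 1 - Poly_Mapping.single z y - Poly_Mapping.single y z | y z. True} \<union>
     {Poly_Mapping.single c 1 | c. c \<in> K})"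

definition differential_class :: "'a::field set \<Rightarrow> ('a \<Rightarrow>\<^sub>0 'a) \<Rightarrow> ('a \<Rightarrow>\<^sub>0 'a) set" where
  "differential_class K g = {h. h - g \<in> kaehler_relations K}"

definition differentials :: "'a::field set \<Rightarrow> ('a \<Rightarrow>\<^sub>0 'a) set set" where
  "differentials K = range (differential_class K)"

text \<open>The differential form \<open>f dx\<close>.\<close>

definition form :: "'a::field set \<Rightarrow> 'a \<Rightarrow> 'a \<Rightarrow> ('a \<Rightarrow>\<^sub>0 'a) set" where
  "form K f x = differential_class K (Poly_Mapping.single x f)"

text \<open>
  For a perfect field \<open>K\<close> and a uniformizer \<open>t\<close> at a place, \<open>dt\<close> is a basis of the
  one-dimensional space of rational differential forms.  The order and the residue of
  \<open>f dt\<close> are the order of \<open>f\<close> and the coefficient of \<open>t\<^sup>-\<^sup>1\<close> in the \<open>t\<close>-adic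
  expansion of \<open>f\<close>; neither depends on the choice of \<open>t\<close>.
\<close>

definition uniformizer :: "('a::field \<Rightarrow> int) \<Rightarrow> 'a" where
  "uniformizer v = (SOME t. v t = 1)"

definition local_coeff :: "'a::field set \<Rightarrow> ('a \<Rightarrow> int) \<Rightarrow> ('a \<Rightarrow>\<^sub>0 'a) set \<Rightarrow> 'a" where
  "local_coeff K v \<omega> = (THE f. \<omega> = form K f (uniformizer v))"

definition ord_form :: "'a::field set \<Rightarrow> ('a \<Rightarrow> int) \<Rightarrow> ('a \<Rightarrow>\<^sub>0 'a) set \<Rightarrow> int" where
  "ord_form K v \<omega> = v (local_coeff K v \<omega>)"

definition laurent_expansion ::
    "'a::field set \<Rightarrow> ('a \<Rightarrow> int) \<Rightarrow> 'a \<Rightarrow> 'a \<Rightarrow> (int \<Rightarrow> 'a) \<Rightarrow> bool" where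
  "laurent_expansion K v t f a \<longleftrightarrow> (\<forall>i. a i \<in> K) \<and>
     (\<exists>M. (\<forall>i<M. a i = 0) \<and>
        (\<forall>N. let r = f - (\<Sum>i\<in>{M..N}. a i * t powi i) in r = 0 \<or> N < v r))"

text \<open>Only used at rational places, where expansions with coefficients in \<open>K\<close> exist.\<close>

definition residue_at :: "'a::field set \<Rightarrow> ('a \<Rightarrow> int) \<Rightarrow> ('a \<Rightarrow>\<^sub>0 'a) set \<Rightarrow> 'a" where
  "residue_at K v \<omega> =
     (THE r. \<exists>a. laurent_expansion K v (uniformizer v) (local_coeff K v \<omega>) a \<and> r = a (-1))"

definition Omega :: "'a::field set \<Rightarrow> 'a divisor \<Rightarrow> ('a \<Rightarrow>\<^sub>0 'a) set set" where
  "Omega K A = {\<omega> \<in> differentials K.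
     \<forall>v\<in>places K. \<omega> = differential_class K 0 \<or> A v \<le> ord_form K v \<omega>}"

text \<open>
  \<^term>\<open>\<Union> (Omega K A)\<close> is the space of formal sums representing elements of
  \<^term>\<open>Omega K A\<close>, so the quotient is \<^term>\<open>Omega K A\<close> itself.
\<close>

definition h1 :: "'a::field set \<Rightarrow> 'a divisor \<Rightarrow> enat" where
  "h1 K A = quotient_dim K formal_scale (\<Union> (Omega K A)) (kaehler_relations K)"


section \<open>The Cartier operator\<close>

text \<open>The operator does not depend on the choice of the separating element.\<close>

definition separating_element :: "'a::field set \<Rightarrow> 'a" where
  "separating_element K = (SOME x. separating K x)"

definition cartier :: "'a::field set \<Rightarrow> nat \<Rightarrow> ('a \<Rightarrow>\<^sub>0 'a) set \<Rightarrow> ('a \<Rightarrow>\<^sub>0 'a) set" where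
  "cartier K p \<omega> =
     (let x = separating_element K in
      THE \<eta>. \<exists>f. \<omega> = form K (\<Sum>i<p. f i ^ p * x ^ i) x \<and> \<eta> = form K (f (p - 1)) x)"

text \<open>For \<open>q = p ^ m\<close>, this is the operator \<open>\<C>\<^sub>q\<close>.\<close>

definition cartier_iter ::
    "'a::field set \<Rightarrow> nat \<Rightarrow> nat \<Rightarrow> ('a \<Rightarrow>\<^sub>0 'a) set \<Rightarrow> ('a \<Rightarrow>\<^sub>0 'a) set" where
  "cartier_iter K p m = cartier K p ^^ m"


section \<open>Codes\<close>

definition residue_vector ::
    "'a::field set \<Rightarrow> ('n::finite \<Rightarrow> 'a \<Rightarrow> int) \<Rightarrow> ('a \<Rightarrow>\<^sub>0 'a) set \<Rightarrow> 'a ^ 'n" where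
  "residue_vector K P \<omega> = (\<chi> i. residue_at K (P i) \<omega>)"

definition AG_code ::
    "'a::field set \<Rightarrow> ('n::finite \<Rightarrow> 'a \<Rightarrow> int) \<Rightarrow> 'a divisor \<Rightarrow> ('a ^ 'n) set" where
  "AG_code K P G = residue_vector K P ` Omega K (\<lambda>v. G v - sum_of_points P v)"

definition subfield_subcode :: "'a set \<Rightarrow> ('a ^ 'n) set \<Rightarrow> ('a ^ 'n) set" where
  "subfield_subcode k C = {c \<in> C. \<forall>i. c $ i \<in> k}"

definition cartier_code ::
    "'a::field set \<Rightarrow> nat \<Rightarrow> nat \<Rightarrow> ('n::finite \<Rightarrow> 'a \<Rightarrow> int) \<Rightarrow> 'a divisor \<Rightarrow> ('a ^ 'n) set" where
  "cartier_code K p m P G =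
     residue_vector K P `
       {\<omega> \<in> Omega K (\<lambda>v. G v - sum_of_points P v). cartier_iter K p m \<omega> = \<omega>}"

end

theory Submission
  imports Defs
begin

text \<open>
  For a differential form \<open>\<omega>\<close> of \<open>\<Omega>(G - D)\<close> with residues in \<open>\<F>\<^sub>q\<close>, the form \<open>\<C>\<^sub>q(\<omega>) - \<omega>\<close> has no
  poles in \<open>D\<close>, and \<open>G \<ge> q G\<^sub>1\<close>, \<open>G \<ge> G\<^sub>1\<close> put it into \<open>\<Omega>(G\<^sub>1)\<close>.  The kernel of \<open>\<C>\<^sub>q - 1\<close> gives the Cartier
  code, so the quotient of the codes is bounded by \<open>\<Omega>(G\<^sub>1)\<close>, of size \<open>q\<close> to the power
  \<open>\<ell> h\<^sup>1(G\<^sub>1)\<close>.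

  A uniformizer \<open>t\<close> at one of the rational points satisfies
  \<open>F = F\<^sup>p \<oplus> F\<^sup>p t \<oplus> \<dots> \<oplus> F\<^sup>p t\<^sup>p\<^sup>-\<^sup>1\<close>: the powers are independent because their valuations
  are distinct modulo \<open>p\<close>, and they generate because \<open>[F : F\<^sup>p] \<le> p\<close>.  This yields the derivation
  \<open>d/dt\<close> and identifies \<open>\<omega> = f dt\<close> with \<open>f\<close>.  The Cartier operator is then computed with respect
  to any \<open>y\<close> with \<open>dy \<noteq> 0\<close>, in particular with respect to the local uniformizers, which gives its
  effect on orders and residues.
\<close>

section \<open>Linear algebra over a subfield\<close>

text \<open>Dimensions are compared by counting, since all coefficient fields are finite. If
  \<open>B\<close> represents a basis of the quotient and h^1(G_1) = h is finite, then q^|B| <=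
  |\<Omega>(G_1)| <= |K|^h = q^(l h). Finiteness of h^1 is never proved: an infinite value makes the
  bound trivial. The factor l arises because C_q - 1 is linear over F_q, whereas h^1 counts
  dimensions over K.

  The obstacle is that the separating element and the uniformizers in the definitions are arbitrary
  choices, so the operator, orders and residues can be computed only when all variables are treated
  alike. The bound [F : F^p] <= p does this: every y with dy \<noteq> 0 has powers 1, ..., y^(p-1)
  that form a basis over F^p. That a separating element exists at all needs a descent on the
  valuation at a rational point, which yields a non-p-th power z with F finite over K(z).\<close>

context
  fixes k :: "'a::field set"
  assumes sub: "is_subfield k"
begin

lemma subfield_closed:
  shows "0 \<in> k" "1 \<in> k"
    and "x \<in> k \<Longrightarrow> y \<in> k \<Longrightarrow> x + y \<in> k"
    and "x \<in> k \<Longrightarrow> y \<in> k \<Longrightarrow> x * y \<in> k"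
    and "x \<in> k \<Longrightarrow> - x \<in> k"
    and "x \<in> k \<Longrightarrow> inverse x \<in> k"
  using sub by (auto simp: is_subfield_def)

lemma subfield_diff: "x \<in> k \<Longrightarrow> y \<in> k \<Longrightarrow> x - y \<in> k"
  using subfield_closed by (metis diff_conv_add_uminus)

lemma subfield_divide: "x \<in> k \<Longrightarrow> y \<in> k \<Longrightarrow> x / y \<in> k"
  using subfield_closed by (metis divide_inverse)

lemma subfield_power: "x \<in> k \<Longrightarrow> x ^ n \<in> k"
  by (induction n) (auto intro: subfield_closed)

lemma subfield_sum: "(\<And>i. i \<in> I \<Longrightarrow> f i \<in> k) \<Longrightarrow> sum f I \<in> k"
  by (induction I rule: infinite_finite_induct) (auto intro: subfield_closed)

lemma subfield_of_nat: "of_nat n \<in> k"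
  by (induction n) (auto intro: subfield_closed)

lemma poly_in_subfield: "f \<in> polys_over k \<Longrightarrow> x \<in> k \<Longrightarrow> poly f x \<in> k"
  by (auto simp: polys_over_def poly_altdef intro!: subfield_sum subfield_closed subfield_power)

lemma polys_over_closed:
  shows "0 \<in> polys_over k" "1 \<in> polys_over k"
    and "f \<in> polys_over k \<Longrightarrow> g \<in> polys_over k \<Longrightarrow> f + g \<in> polys_over k"
    and "f \<in> polys_over k \<Longrightarrow> g \<in> polys_over k \<Longrightarrow> f - g \<in> polys_over k"
    and "f \<in> polys_over k \<Longrightarrow> - f \<in> polys_over k"
    and "f \<in> polys_over k \<Longrightarrow> g \<in> polys_over k \<Longrightarrow> f * g \<in> polys_over k"
    and "f \<in> polys_over k \<Longrightarrow> pderiv f \<in> polys_over k"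
    and "a \<in> k \<Longrightarrow> monom a n \<in> polys_over k"
    and "pCons a f \<in> polys_over k \<longleftrightarrow> a \<in> k \<and> f \<in> polys_over k"
          apply (auto simp: polys_over_def coeff_mult coeff_pderiv coeff_1
          intro!: subfield_closed subfield_diff subfield_sum)
  subgoal by (metis coeff_pderiv of_nat_Suc subfield_closed(4) subfield_of_nat)
  subgoal by (metis coeff_pCons_0)
  subgoal by (metis coeff_pCons_Suc)
  subgoal by (simp add: coeff_pCons split: nat.split)
  done

lemma polys_over_power: "f \<in> polys_over k \<Longrightarrow> f ^ n \<in> polys_over k"
  by (induction n) (auto intro: polys_over_closed)

lemma subfield_subset_adjoin: "k \<subseteq> adjoin k x"
proof
  fix a assume "a \<in> k"
  then have "[:a:] \<in> polys_over k" "[:1:] \<in> polys_over k"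
    by (simp_all add: polys_over_closed subfield_closed)
  then show "a \<in> adjoin k x"
    unfolding adjoin_def by (intro CollectI exI[of _ "[:a:]"] exI[of _ "[:1:]"]) auto
qed

lemma generator_in_adjoin: "x \<in> adjoin k x"
proof -
  have "[:0, 1:] \<in> polys_over k" "[:1:] \<in> polys_over k"
    by (simp_all add: polys_over_closed subfield_closed)
  then show ?thesis
    unfolding adjoin_def by (intro CollectI exI[of _ "[:0, 1:]"] exI[of _ "[:1:]"]) auto
qed

lemma adjoinI:
  "f \<in> polys_over k \<Longrightarrow> g \<in> polys_over k \<Longrightarrow> poly g x \<noteq> 0 \<Longrightarrow> y = poly f x / poly g x \<Longrightarrow> y \<in> adjoin k x"
  by (auto simp: adjoin_def)

lemma poly_in_adjoin: "f \<in> polys_over k \<Longrightarrow> poly f x \<in> adjoin k x"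
  by (rule adjoinI[of f 1]) (auto intro: polys_over_closed)

lemma is_subfield_adjoin: "is_subfield (adjoin k x)"
  unfolding is_subfield_def
proof (intro conjI ballI)
  show "0 \<in> adjoin k x" "1 \<in> adjoin k x"
    using subfield_subset_adjoin subfield_closed by auto
next
  fix y z assume "y \<in> adjoin k x" "z \<in> adjoin k x"
  then obtain f g f' g' where *: "f \<in> polys_over k" "g \<in> polys_over k" "poly g x \<noteq> 0"
     "f' \<in> polys_over k" "g' \<in> polys_over k" "poly g' x \<noteq> 0"
     "y = poly f x / poly g x" "z = poly f' x / poly g' x"
    by (auto simp: adjoin_def)
  show "y + z \<in> adjoin k x"
    by (rule adjoinI[of "f * g' + f' * g" "g * g'"])
       (use * in \<open>auto intro!: polys_over_closed simp: add_frac_eq mult.commute\<close>)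
  show "y * z \<in> adjoin k x"
    by (rule adjoinI[of "f * f'" "g * g'"]) (use * in \<open>auto intro!: polys_over_closed\<close>)
next
  fix y assume "y \<in> adjoin k x"
  then obtain f g where *: "f \<in> polys_over k" "g \<in> polys_over k" "poly g x \<noteq> 0"
     "y = poly f x / poly g x"
    by (auto simp: adjoin_def)
  show "- y \<in> adjoin k x"
    by (rule adjoinI[of "- f" g]) (use * in \<open>auto intro!: polys_over_closed\<close>)
  show "inverse y \<in> adjoin k x"
  proof (cases "poly f x = 0")
    case True
    then show ?thesis using * \<open>y \<in> adjoin k x\<close> by simp
  next
    case False
    then show ?thesis by (intro adjoinI[of g f]) (use * in auto)
  qed
qed

end

lemma adjoin_least:
  assumes "is_subfield L" "k \<subseteq> L" "x \<in> L"
  shows "adjoin k x \<subseteq> L"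
proof -
  have "polys_over k \<subseteq> polys_over L" using assms by (auto simp: polys_over_def)
  then show ?thesis
    unfolding adjoin_def using assms by (auto intro!: subfield_divide poly_in_subfield)
qed

text \<open>Gaussian elimination: a vector with nonzero coordinate at \<open>s\<close> clears that
  coordinate from the others, leaving one vector and one spanning element fewer. The vectors are an
  indexed family, so that a repeated value counts as a dependence.\<close>

lemma more_than_spanning_dependent:
  fixes k :: "'a::field set" and e :: "'s \<Rightarrow> 'a" and u :: "'i \<Rightarrow> 'a"
  assumes k: "is_subfield k"
  assumes "finite S" "finite I" "card S < card I"
    and "\<And>i. i \<in> I \<Longrightarrow> \<exists>c. (\<forall>s\<in>S. c s \<in> k) \<and> u i = (\<Sum>s\<in>S. c s * e s)"
  shows "\<exists>d. (\<forall>i\<in>I. d i \<in> k) \<and> (\<exists>i\<in>I. d i \<noteq> 0) \<and> (\<Sum>i\<in>I. d i * u i) = 0"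
  using assms(2-)
proof (induction S arbitrary: I u rule: finite_induct)
  case empty
  then have "u i = 0" if "i \<in> I" for i using that by auto
  moreover obtain i where "i \<in> I" using empty by fastforce
  ultimately show ?case
    by (intro exI[of _ "\<lambda>_. 1"]) (auto intro: subfield_closed[OF k])
next
  case (insert s S)
  from insert.prems(3) obtain c where c: "\<And>i t. i \<in> I \<Longrightarrow> t \<in> insert s S \<Longrightarrow> c i t \<in> k"
    "\<And>i. i \<in> I \<Longrightarrow> u i = (\<Sum>t\<in>insert s S. c i t * e t)"
    by metis
  have u: "u i = c i s * e s + (\<Sum>t\<in>S. c i t * e t)" if "i \<in> I" for i
    using c(2)[OF that] insert.hyps by simp
  show ?case
  proof (cases "\<exists>i\<in>I. c i s \<noteq> 0")
    case False
    have "card S < card I" using insert by simp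
    moreover have "\<exists>c. (\<forall>s\<in>S. c s \<in> k) \<and> u i = (\<Sum>s\<in>S. c s * e s)" if "i \<in> I" for i
      using u[OF that] c(1)[OF that] False that by (intro exI[of _ "c i"]) auto
    ultimately show ?thesis using insert.IH[of I u] insert.prems by blast
  next
    case True
    then obtain j where j: "j \<in> I" "c j s \<noteq> 0" by auto
    define r where "r i = c i s / c j s" for i
    have r: "r i \<in> k" if "i \<in> I" for i
      using that j c(1) unfolding r_def by (intro subfield_divide[OF k]) auto
    define w where "w i = u i - r i * u j" for i
    have w: "\<exists>d. (\<forall>s\<in>S. d s \<in> k) \<and> w i = (\<Sum>s\<in>S. d s * e s)" if "i \<in> I - {j}" for i
    proof (intro exI[of _ "\<lambda>t. c i t - r i * c j t"] conjI ballI)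
      fix t assume "t \<in> S"
      then show "c i t - r i * c j t \<in> k"
        using that j c(1) r by (intro subfield_diff[OF k] subfield_closed[OF k]) auto
    next
      have "w i = (c i s - r i * c j s) * e s + (\<Sum>t\<in>S. (c i t - r i * c j t) * e t)"
        using that j u[of i] u[of j]
        by (simp add: w_def algebra_simps sum_subtractf sum_distrib_left)
      also have "c i s - r i * c j s = 0" using j by (simp add: r_def)
      finally show "w i = (\<Sum>s\<in>S. (c i s - r i * c j s) * e s)" by simp
    qed
    have "card S < card (I - {j})" using insert j by (simp add: card_Diff_singleton)
    then obtain d where d: "\<forall>i\<in>I - {j}. d i \<in> k" "\<exists>i\<in>I - {j}. d i \<noteq> 0"
      "(\<Sum>i\<in>I - {j}. d i * w i) = 0"
      using insert.IH[of "I - {j}" w] insert.prems w by blast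
    \<comment> \<open>The coefficient of the pivot \<open>u j\<close> collects the multiples of it
      that were subtracted in the vectors \<open>w i\<close>.\<close>
    define d' where "d' = d(j := - (\<Sum>i\<in>I - {j}. d i * r i))"
    have "(\<Sum>i\<in>I. d' i * u i) = d' j * u j + (\<Sum>i\<in>I - {j}. d i * u i)"
      using insert.prems j by (subst sum.remove[of _ j]) (auto simp: d'_def)
    also have "\<dots> = (\<Sum>i\<in>I - {j}. d i * w i)"
      by (simp add: d'_def w_def algebra_simps sum_subtractf sum_distrib_left)
    finally have "(\<Sum>i\<in>I. d' i * u i) = 0" using d by simp
    moreover have "d' i \<in> k" if "i \<in> I" for i
      using that d r
      by (auto simp: d'_def intro!: subfield_closed[OF k] subfield_sum[OF k])
    moreover have "\<exists>i\<in>I. d' i \<noteq> 0" using d by (auto simp: d'_def)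
    ultimately show ?thesis by blast
  qed
qed

section \<open>Fields of characteristic \<open>p\<close> with perfect constants\<close>

text \<open>Until the codes are treated, this is all that is assumed of the size of the constant
  field: characteristic p and perfectness.\<close>

locale perfect_constants =
  fixes p :: nat and K :: "'a::field set"
  assumes prime_p: "prime p"
    and of_nat_p [simp]: "of_nat p = (0 :: 'a)"
    and subfield_K: "is_subfield K"
    and perfect: "c \<in> K \<Longrightarrow> \<exists>a\<in>K. c = a ^ p"
begin

lemma CHAR_eq_p: "CHAR('a) = p"
proof -
  have "CHAR('a) dvd p" using of_nat_p of_nat_eq_0_iff_char_dvd by blast
  moreover have "CHAR('a) \<noteq> 1" using of_nat_CHAR[where ?'a = 'a] by fastforce
  ultimately show ?thesis using prime_p by (auto simp: prime_nat_iff)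
qed

lemma p_pos [simp]: "0 < p" and p_nonzero [simp]: "p \<noteq> 0"
  using prime_p prime_gt_0_nat by auto

lemma of_nat_eq_0_iff_dvd: "of_nat n = (0 :: 'a) \<longleftrightarrow> p dvd n"
  by (metis CHAR_eq_p of_nat_eq_0_iff_char_dvd)

lemma of_nat_less_p_nonzero: "0 < n \<Longrightarrow> n < p \<Longrightarrow> of_nat n \<noteq> (0 :: 'a)"
  by (simp add: of_nat_eq_0_iff_dvd nat_dvd_not_less)

lemma frob_add: "(x + y :: 'a) ^ p = x ^ p + y ^ p"
  by (rule freshmans_dream) (use prime_p CHAR_eq_p in auto)

lemma frob_sum: "(sum f I :: 'a) ^ p = (\<Sum>i\<in>I. f i ^ p)"
  by (rule freshmans_dream_sum) (use prime_p CHAR_eq_p in auto)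

lemma frob_minus: "(- x :: 'a) ^ p = - (x ^ p)"
  using frob_add[of x "- x"] by (simp add: power_0_left eq_neg_iff_add_eq_0 add.commute)

lemma frob_diff: "(x - y :: 'a) ^ p = x ^ p - y ^ p"
  using frob_add[of x "- y"] by (simp add: frob_minus)

lemma frob_inj: "(x :: 'a) ^ p = y ^ p \<longleftrightarrow> x = y"
  using frob_diff[of x y] by auto

lemma frob_of_nat: "of_nat n ^ p = (of_nat n :: 'a)"
  by (induction n) (simp_all add: frob_add)

lemma is_subfield_frob_image:
  assumes k: "is_subfield k" shows "is_subfield ((\<lambda>c. c ^ p) ` k :: 'a set)"
proof -
  have closed: "x + y \<in> (\<lambda>c. c ^ p) ` k" "x * y \<in> (\<lambda>c. c ^ p) ` k" "- x \<in> (\<lambda>c. c ^ p) ` k"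
    "inverse x \<in> (\<lambda>c. c ^ p) ` k"
    if xy: "x \<in> (\<lambda>c. c ^ p) ` k" "y \<in> (\<lambda>c. c ^ p) ` k" for x y :: 'a
  proof -
    obtain a b where "a \<in> k" "b \<in> k" "x = a ^ p" "y = b ^ p" using xy by auto
    then have "x + y = (a + b) ^ p" "x * y = (a * b) ^ p" "- x = (- a) ^ p" "inverse x = inverse a ^ p"
      "a + b \<in> k" "a * b \<in> k" "- a \<in> k" "inverse a \<in> k"
      by (simp_all add: frob_add power_mult_distrib frob_minus power_inverse subfield_closed[OF k])
    then show "x + y \<in> (\<lambda>c. c ^ p) ` k" "x * y \<in> (\<lambda>c. c ^ p) ` k" "- x \<in> (\<lambda>c. c ^ p) ` k"
      "inverse x \<in> (\<lambda>c. c ^ p) ` k"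
      by blast+
  qed
  have "0 \<in> (\<lambda>c. c ^ p) ` k" "1 \<in> (\<lambda>c. c ^ p) ` k"
    using imageI[OF subfield_closed(1)[OF k], of "\<lambda>c. c ^ p"]
      imageI[OF subfield_closed(2)[OF k], of "\<lambda>c. c ^ p"] by (simp_all add: power_0_left)
  then show ?thesis unfolding is_subfield_def
    by (intro conjI ballI) (assumption | rule closed)+
qed

text \<open>Multiplication by x shifts the slots x^j; the term that leaves at the top, g^p x^p, is
  the p-th power (g x)^p and joins slot 0, together with the new constant coefficient, a p-th power
  by perfectness.\<close>

lemma poly_p_decomposition:
  assumes "f \<in> polys_over K"
  shows "\<exists>g. (\<forall>j. g j \<in> adjoin K x) \<and> poly f x = (\<Sum>j<p. g j ^ p * x ^ j)"
  using assms
proof (induction f)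
  case 0
  have "0 \<in> adjoin K x" by (rule subfield_closed(1)[OF is_subfield_adjoin[OF subfield_K]])
  then show ?case by (intro exI[of _ "\<lambda>_. 0"]) (auto simp: power_0_left)
next
  case (pCons a f)
  then have "a \<in> K" "f \<in> polys_over K" by (auto simp: polys_over_closed[OF subfield_K])
  then obtain b g where b: "b \<in> K" "a = b ^ p"
    and g: "\<And>j. g j \<in> adjoin K x" "poly f x = (\<Sum>j<p. g j ^ p * x ^ j)"
    using pCons.IH perfect by metis
  note [simp] = subfield_closed[OF is_subfield_adjoin[OF subfield_K]]
  have "b \<in> adjoin K x" "x \<in> adjoin K x"
    using b subfield_subset_adjoin[OF subfield_K] generator_in_adjoin[OF subfield_K] by auto
  define h where "h j = (if j = 0 then b + g (p - 1) * x else g (j - 1))" for j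
  obtain r where r: "p = Suc r" using p_pos by (cases p) auto
  have "poly (pCons a f) x = b ^ p + (\<Sum>j<p. g j ^ p * x ^ Suc j)"
    by (simp add: b g sum_distrib_left mult_ac)
  also have "(\<Sum>j<p. g j ^ p * x ^ Suc j) = (\<Sum>j<r. g j ^ p * x ^ Suc j) + (g (p - 1) * x) ^ p"
    by (simp add: r power_mult_distrib)
  also have "(\<Sum>j<r. g j ^ p * x ^ Suc j) = (\<Sum>j<r. h (Suc j) ^ p * x ^ Suc j)"
    by (simp add: h_def)
  also have "b ^ p + (\<dots> + (g (p - 1) * x) ^ p) = h 0 ^ p * x ^ 0 + (\<Sum>j<r. h (Suc j) ^ p * x ^ Suc j)"
    by (simp add: h_def frob_add)
  also have "\<dots> = (\<Sum>j<p. h j ^ p * x ^ j)"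
    unfolding r by (rule sum.lessThan_Suc_shift[symmetric])
  finally show ?case
    using g(1) \<open>b \<in> adjoin K x\<close> \<open>x \<in> adjoin K x\<close>
    by (intro exI[of _ h]) (auto simp: h_def)
qed

text \<open>Writing f/h as f h^(p-1) / h^p makes the denominator a p-th power, which the
  coefficients absorb.\<close>

lemma adjoin_p_decomposition:
  assumes "y \<in> adjoin K x"
  shows "\<exists>g. (\<forall>j. g j \<in> adjoin K x) \<and> y = (\<Sum>j<p. g j ^ p * x ^ j)"
proof -
  obtain f h where *: "f \<in> polys_over K" "h \<in> polys_over K" "poly h x \<noteq> 0" "y = poly f x / poly h x"
    using assms by (auto simp: adjoin_def)
  have "f * h ^ (p - 1) \<in> polys_over K"
    using * by (intro polys_over_closed[OF subfield_K] polys_over_power[OF subfield_K])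
  then obtain g where g: "\<And>j. g j \<in> adjoin K x"
    "poly (f * h ^ (p - 1)) x = (\<Sum>j<p. g j ^ p * x ^ j)"
    using poly_p_decomposition by blast
  have "y = poly (f * h ^ (p - 1)) x / poly h x ^ p"
    using * by (simp add: power_eq_if[of _ p] )
  also have "\<dots> = (\<Sum>j<p. (g j / poly h x) ^ p * x ^ j)"
    unfolding g(2) by (simp add: sum_divide_distrib power_divide)
  finally show ?thesis
    using g(1) poly_in_adjoin[OF subfield_K *(2)]
    by (intro exI[of _ "\<lambda>j. g j / poly h x"])
       (auto intro!: subfield_divide[OF is_subfield_adjoin[OF subfield_K]])
qed

definition finite_over :: "'a \<Rightarrow> bool" where
  "finite_over x \<longleftrightarrow>
     (\<exists>B. finite B \<and> (\<forall>y. \<exists>c. (\<forall>b\<in>B. c b \<in> adjoin K x) \<and> y = (\<Sum>b\<in>B. c b * b)))"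

text \<open>
  If \<open>B\<close> is a basis of \<open>F\<close> over \<open>k = K(x)\<close>, then \<open>F\<close> is spanned over \<open>k\<^sup>p\<close> by \<open>p \<cdot> |B|\<close>
  elements, whereas \<open>p + 1\<close> elements independent over \<open>F\<^sup>p\<close> would give \<open>(p + 1) \<cdot> |B|\<close> elements
  independent over \<open>k\<^sup>p\<close>.
\<close>

lemma dependent_over_pth_powers:
  assumes "finite_over x"
  shows "\<exists>c. (\<exists>j\<le>p. c j \<noteq> 0) \<and> (\<Sum>j\<le>p. c j ^ p * u j) = (0 :: 'a)"
proof -
  define k where "k = adjoin K x"
  have k: "is_subfield k" by (simp add: k_def is_subfield_adjoin[OF subfield_K])
  define spans where
    "spans B \<longleftrightarrow> finite B \<and> (\<forall>y. \<exists>c. (\<forall>b\<in>B. c b \<in> k) \<and> y = (\<Sum>b\<in>B. c b * b))" for B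
  have "\<exists>B. spans B" using assms by (auto simp: finite_over_def spans_def k_def)
  \<comment> \<open>A spanning set of least size is independent, since an element occurring in a
    relation could be discarded.\<close>
  then obtain B where B: "spans B" and least: "\<And>B'. spans B' \<Longrightarrow> card B \<le> card B'"
    using ex_has_least_nat[of spans _ card] by blast
  have fin: "finite B" using B by (simp add: spans_def)
  have indep: "c b = 0" if c: "\<forall>b\<in>B. c b \<in> k" "(\<Sum>b\<in>B. c b * b) = 0" and b: "b \<in> B" for c b
  proof (rule ccontr)
    assume nz: "c b \<noteq> 0"
    have "c b * b = - (\<Sum>b'\<in>B - {b}. c b' * b')"
      using c(2) b fin by (simp add: sum.remove add_eq_0_iff)
    then have eq: "b = (\<Sum>b'\<in>B - {b}. (- c b' / c b) * b')"
      using nz by (simp add: sum_negf field_simps flip: sum_divide_distrib)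
    have "spans (B - {b})"
      unfolding spans_def
    proof (intro conjI allI)
      fix y
      obtain d where d: "\<forall>b\<in>B. d b \<in> k" "y = (\<Sum>b\<in>B. d b * b)" using B by (auto simp: spans_def)
      have "y = d b * b + (\<Sum>b'\<in>B - {b}. d b' * b')"
        using d(2) b fin by (simp add: sum.remove)
      also have "d b * b = (\<Sum>b'\<in>B - {b}. d b * (- c b' / c b) * b')"
        by (subst eq) (simp add: sum_distrib_left mult.assoc)
      also have "\<dots> + (\<Sum>b'\<in>B - {b}. d b' * b') =
          (\<Sum>b'\<in>B - {b}. (d b * (- c b' / c b) + d b') * b')"
        by (simp only: sum.distrib distrib_right)
      finally have "y = (\<Sum>b'\<in>B - {b}. (d b * (- c b' / c b) + d b') * b')" .
      moreover have "\<forall>b'\<in>B - {b}. d b * (- c b' / c b) + d b' \<in> k"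
        by (intro ballI subfield_closed(3-5)[OF k] subfield_divide[OF k]) (use d c b in auto)
      ultimately show "\<exists>c. (\<forall>b\<in>B - {b}. c b \<in> k) \<and> y = (\<Sum>b\<in>B - {b}. c b * b)"
        by (intro exI[of _ "\<lambda>b'. d b * (- c b' / c b) + d b'"] conjI)
    qed (use fin in auto)
    then have "card B \<le> card (B - {b})" by (rule least)
    then show False using b fin by (meson card_Diff1_less not_less)
  qed
  have "B \<noteq> {}"
  proof
    assume "B = {}"
    then have "\<forall>y :: 'a. y = 0" using B by (auto simp: spans_def)
    then show False using one_neq_zero by blast
  qed
  define kp where "kp = (\<lambda>c. c ^ p) ` k"
  have kp: "is_subfield kp" unfolding kp_def by (rule is_subfield_frob_image[OF k])
  have "\<exists>c. (\<forall>s\<in>{..<p} \<times> B. c s \<in> kp) \<and> y = (\<Sum>s\<in>{..<p} \<times> B. c s * (x ^ fst s * snd s))" for y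
  proof -
    obtain c where c: "\<forall>b\<in>B. c b \<in> k" "y = (\<Sum>b\<in>B. c b * b)" using B by (auto simp: spans_def)
    have "\<forall>b\<in>B. \<exists>g. (\<forall>j. g j \<in> k) \<and> c b = (\<Sum>j<p. g j ^ p * x ^ j)"
      using c(1) adjoin_p_decomposition unfolding k_def by blast
    then obtain g where g: "\<And>b j. b \<in> B \<Longrightarrow> g b j \<in> k"
      "\<And>b. b \<in> B \<Longrightarrow> c b = (\<Sum>j<p. g b j ^ p * x ^ j)" by metis
    have "y = (\<Sum>b\<in>B. \<Sum>j<p. g b j ^ p * (x ^ j * b))"
      unfolding c(2) by (intro sum.cong) (simp_all add: g(2) sum_distrib_right mult.assoc)
    also have "\<dots> = (\<Sum>s\<in>{..<p} \<times> B. g (snd s) (fst s) ^ p * (x ^ fst s * snd s))"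
      by (subst sum.swap) (simp add: sum.cartesian_product case_prod_unfold)
    finally show ?thesis
      using g(1) by (intro exI[of _ "\<lambda>s. g (snd s) (fst s) ^ p"]) (auto simp: kp_def)
  qed
  moreover have "card ({..<p} \<times> B) < card ({..p} \<times> B)"
    using \<open>B \<noteq> {}\<close> fin by (simp add: card_cartesian_product card_gt_0_iff)
  ultimately have "\<exists>d. (\<forall>i\<in>{..p} \<times> B. d i \<in> kp) \<and> (\<exists>i\<in>{..p} \<times> B. d i \<noteq> 0) \<and>
      (\<Sum>i\<in>{..p} \<times> B. d i * (u (fst i) * snd i ^ p)) = 0"
    using fin
    by (intro more_than_spanning_dependent[OF kp, where e = "\<lambda>s. x ^ fst s * snd s" and S = "{..<p} \<times> B"]) auto
  then obtain d where d: "\<forall>i\<in>{..p} \<times> B. d i \<in> kp" "\<exists>i\<in>{..p} \<times> B. d i \<noteq> 0"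
      "(\<Sum>i\<in>{..p} \<times> B. d i * (u (fst i) * snd i ^ p)) = 0"
    by (elim exE conjE)
  have "\<forall>i\<in>{..p} \<times> B. \<exists>e. e \<in> k \<and> d i = e ^ p" using d(1) unfolding kp_def by blast
  then obtain e where e: "\<And>i. i \<in> {..p} \<times> B \<Longrightarrow> e i \<in> k" "\<And>i. i \<in> {..p} \<times> B \<Longrightarrow> d i = e i ^ p"
    by metis
  \<comment> \<open>The coefficients are p-th powers, so the sum of e^p b^p over \<open>B\<close>
    collapses to a single p-th power.\<close>
  define c where "c j = (\<Sum>b\<in>B. e (j, b) * b)" for j
  have "(\<Sum>j\<le>p. c j ^ p * u j) = (\<Sum>j\<le>p. \<Sum>b\<in>B. e (j, b) ^ p * (u j * b ^ p))"
    unfolding c_def frob_sum sum_distrib_right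
    by (intro sum.cong) (simp_all add: power_mult_distrib mult_ac)
  also have "\<dots> = (\<Sum>i\<in>{..p} \<times> B. d i * (u (fst i) * snd i ^ p))"
    using e(2) by (simp add: sum.cartesian_product case_prod_unfold)
  finally have "(\<Sum>j\<le>p. c j ^ p * u j) = 0" using d(3) by simp
  moreover have "\<exists>j\<le>p. c j \<noteq> 0"
  proof -
    obtain j b where jb: "j \<le> p" "b \<in> B" "d (j, b) \<noteq> 0" using d(2) by auto
    then have "e (j, b) \<noteq> 0" using e(2)[of "(j, b)"] by (auto simp: power_0_left)
    then have "c j \<noteq> 0" using indep[of "\<lambda>b. e (j, b)" b] jb e(1) by (auto simp: c_def)
    then show ?thesis using jb by auto
  qed
  ultimately show ?thesis by blast
qed

end

section \<open>\<open>p\<close>-bases, derivations and the Cartier operator on functions\<close>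

text \<open>The coordinates over F^p are recorded through their p-th roots, because the Cartier
  operator returns one of these roots.\<close>

locale p_basis = perfect_constants p K for p :: nat and K :: "'a::field set" +
  fixes t :: 'a
  assumes p_span: "\<exists>f. y = (\<Sum>i<p. f i ^ p * t ^ i)"
    and p_indep: "(\<Sum>i<p. f i ^ p * t ^ i) = 0 \<Longrightarrow> i < p \<Longrightarrow> f i = 0"

text \<open>The p powers of x together with y are p + 1 elements, hence dependent over F^p;
  independence of the powers makes the coefficient of y nonzero, so the relation can be solved for
  y.\<close>

lemma (in perfect_constants) p_basis_of_independent:
  assumes "finite_over x0"
    and indep: "\<And>f i. (\<Sum>i<p. f i ^ p * x ^ i) = 0 \<Longrightarrow> i < p \<Longrightarrow> f i = 0"
  shows "p_basis p K x"
proof unfold_locales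
  fix f i assume "(\<Sum>i<p. f i ^ p * x ^ i) = 0" "i < p"
  then show "f i = 0" by (rule indep)
next
  fix y
  define u where "u j = (if j < p then x ^ j else y)" for j
  obtain c where c: "\<exists>j\<le>p. c j \<noteq> 0" "(\<Sum>j\<le>p. c j ^ p * u j) = 0"
    using dependent_over_pth_powers[OF assms(1)] by blast
  have eq: "(\<Sum>j<p. c j ^ p * x ^ j) + c p ^ p * y = 0"
    using c(2) by (simp add: u_def flip: lessThan_Suc_atMost)
  have "c p \<noteq> 0"
  proof
    assume "c p = 0"
    then have "c j = 0" if "j < p" for j
      using eq that indep[of c j] by (simp add: power_0_left)
    then show False using c(1) \<open>c p = 0\<close> by (metis le_neq_implies_less)
  qed
  then have "y = - (\<Sum>j<p. c j ^ p * x ^ j) / c p ^ p"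
    using eq by (simp add: eq_neg_iff_add_eq_0 field_simps)
  also have "\<dots> = (\<Sum>j<p. (- c j / c p) ^ p * x ^ j)"
    by (simp add: frob_minus power_divide sum_divide_distrib sum_negf)
  finally show "\<exists>f. y = (\<Sum>i<p. f i ^ p * x ^ i)" by (rule exI[of _ "\<lambda>j. - c j / c p"])
qed

section \<open>Coordinates over F^p, the derivation d/dt, and the Cartier operator on
  functions\<close>

context p_basis
begin

text \<open>The value 0 from p on lets formulas that refer to index i + 1, such as
  \<open>p_coeff_D\<close>, hold at i = p - 1 as well.\<close>

definition p_coeff :: "'a \<Rightarrow> nat \<Rightarrow> 'a" where
  "p_coeff y i = (if i < p then (SOME f. y = (\<Sum>i<p. f i ^ p * t ^ i)) i else 0)"

lemma p_coeff_sum: "y = (\<Sum>i<p. p_coeff y i ^ p * t ^ i)"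
proof -
  have "y = (\<Sum>i<p. (SOME f. y = (\<Sum>i<p. f i ^ p * t ^ i)) i ^ p * t ^ i)"
    by (rule someI_ex[OF p_span])
  then show ?thesis by (simp add: p_coeff_def)
qed

lemma p_coeff_eqI:
  assumes "y = (\<Sum>i<p. f i ^ p * t ^ i)" "i < p"
  shows "p_coeff y i = f i"
proof -
  have "(\<Sum>i<p. (p_coeff y i - f i) ^ p * t ^ i) = 0"
    using p_coeff_sum[of y] assms(1) by (simp add: frob_diff left_diff_distrib sum_subtractf)
  from p_indep[OF this assms(2)] show ?thesis by simp
qed

lemma p_coeff_ge [simp]: "p \<le> i \<Longrightarrow> p_coeff y i = 0"
  by (simp add: p_coeff_def)

lemma p_coeff_add: "p_coeff (y + z) i = p_coeff y i + p_coeff z i"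
proof (cases "i < p")
  case True
  have "y + z = (\<Sum>i<p. (p_coeff y i + p_coeff z i) ^ p * t ^ i)"
    by (subst p_coeff_sum[of y], subst p_coeff_sum[of z])
       (simp add: frob_add distrib_right sum.distrib)
  then show ?thesis using True by (rule p_coeff_eqI)
qed simp

lemma p_coeff_scale: "p_coeff (a ^ p * y) i = a * p_coeff y i"
proof (cases "i < p")
  case True
  have "a ^ p * y = (\<Sum>i<p. (a * p_coeff y i) ^ p * t ^ i)"
    by (subst p_coeff_sum[of y]) (simp add: power_mult_distrib sum_distrib_left mult.assoc)
  then show ?thesis using True by (rule p_coeff_eqI)
qed simp

lemma p_coeff_0 [simp]: "p_coeff 0 i = 0"
  using p_coeff_scale[of 0 0 i] by simp

lemma p_coeff_power: "r < p \<Longrightarrow> p_coeff (t ^ r) i = (if i = r then 1 else 0)"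
proof (cases "i < p")
  case True
  assume r: "r < p"
  have "t ^ r = (\<Sum>i<p. (if i = r then 1 else 0) ^ p * t ^ i)"
    using r by (simp add: if_distrib[of "\<lambda>x. x ^ p"] power_0_left if_distrib[of "\<lambda>x. x * _"] cong: if_cong)
  then show ?thesis using True by (rule p_coeff_eqI)
qed auto

text \<open>Formal d/dt with p-th powers as constants. At i = 0 the truncated exponent
  \<open>i - 1\<close> is harmless, because the factor \<open>of_nat i\<close> is 0.\<close>

definition D :: "'a \<Rightarrow> 'a" where
  "D y = (\<Sum>i<p. of_nat i * p_coeff y i ^ p * t ^ (i - 1))"

lemma D_add: "D (y + z) = D y + D z"
  by (simp add: D_def p_coeff_add frob_add algebra_simps sum.distrib)

lemma D_scale: "D (a ^ p * y) = a ^ p * D y"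
  unfolding D_def p_coeff_scale sum_distrib_left
  by (intro sum.cong) (simp_all add: power_mult_distrib mult_ac)

lemma D_0 [simp]: "D 0 = 0"
  by (simp add: D_def power_0_left)

lemma D_sum: "D (sum f I) = (\<Sum>i\<in>I. D (f i))"
  by (induction I rule: infinite_finite_induct) (auto simp: D_add)

text \<open>The definition shows this only for exponents below p, but the Leibniz rule meets larger
  ones. Splitting off the p-th power (t^(n div p))^p reduces n to its residue modulo p, which is the
  same element of F.\<close>

lemma D_power_generator: "D (t ^ n) = of_nat n * t ^ (n - 1)"
proof -
  define r where "r = n mod p"
  have r: "r < p" by (simp add: r_def)
  have n: "n = n div p * p + r" by (simp add: r_def)
  have of_nat_n: "of_nat n = (of_nat r :: 'a)" by (subst n) simp
  have "D (t ^ r) = (\<Sum>i<p. if i = r then of_nat r * t ^ (r - 1) else 0)"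
    unfolding D_def by (intro sum.cong) (auto simp: p_coeff_power r power_0_left)
  then have Dr: "D (t ^ r) = of_nat r * t ^ (r - 1)" using r by simp
  have "D (t ^ n) = D ((t ^ (n div p)) ^ p * t ^ r)"
    by (subst n) (simp add: power_add power_mult)
  also have "\<dots> = (t ^ (n div p)) ^ p * (of_nat r * t ^ (r - 1))"
    by (simp only: D_scale Dr)
  also have "\<dots> = of_nat n * t ^ (n - 1)"
  proof (cases "r = 0")
    case False
    then have "n - 1 = n div p * p + (r - 1)" using n by linarith
    then show ?thesis by (simp add: of_nat_n power_add power_mult)
  qed (simp add: of_nat_n)
  finally show ?thesis .
qed

lemma D_generator [simp]: "D t = 1"
  using D_power_generator[of 1] by simp

text \<open>Both sides are additive and F^p-linear in y and in z, so powers of t suffice; they are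
  inserted first for y, then for z.\<close>

lemma D_mult: "D (y * z) = y * D z + z * D y"
proof -
  have tt: "D (t ^ i * t ^ j) = t ^ i * D (t ^ j) + t ^ j * D (t ^ i)" for i j
    unfolding power_add[symmetric] D_power_generator
    by (cases i; cases j) (simp_all add: algebra_simps power_add)
  have yt: "D (y * t ^ j) = y * D (t ^ j) + t ^ j * D y" for j
  proof -
    have "y * t ^ j = (\<Sum>i<p. p_coeff y i ^ p * (t ^ i * t ^ j))"
      by (subst p_coeff_sum[of y]) (simp add: sum_distrib_right mult.assoc)
    then have "D (y * t ^ j) = (\<Sum>i<p. p_coeff y i ^ p * (t ^ i * D (t ^ j) + t ^ j * D (t ^ i)))"
      by (simp add: D_sum D_scale tt)
    also have "\<dots> = (\<Sum>i<p. p_coeff y i ^ p * t ^ i) * D (t ^ j) + t ^ j * D (\<Sum>i<p. p_coeff y i ^ p * t ^ i)"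
      unfolding D_sum D_scale sum_distrib_left sum_distrib_right sum.distrib[symmetric]
      by (intro sum.cong) (simp_all add: algebra_simps)
    finally show ?thesis by (simp flip: p_coeff_sum)
  qed
  have "y * z = (\<Sum>j<p. p_coeff z j ^ p * (y * t ^ j))"
    by (subst p_coeff_sum[of z]) (simp add: sum_distrib_left mult_ac)
  then have "D (y * z) = (\<Sum>j<p. p_coeff z j ^ p * (y * D (t ^ j) + t ^ j * D y))"
    by (simp add: D_sum D_scale yt)
  also have "\<dots> = y * D (\<Sum>j<p. p_coeff z j ^ p * t ^ j) + (\<Sum>j<p. p_coeff z j ^ p * t ^ j) * D y"
    unfolding D_sum D_scale sum_distrib_left sum_distrib_right sum.distrib[symmetric]
    by (intro sum.cong) (simp_all add: algebra_simps)
  finally show ?thesis by (simp flip: p_coeff_sum)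
qed

lemma D_1 [simp]: "D 1 = 0"
  using D_power_generator[of 0] by simp

lemma D_power: "D (y ^ n) = of_nat n * y ^ (n - 1) * D y"
proof (induction n)
  case (Suc n)
  then show ?case by (cases n) (simp_all add: D_mult algebra_simps)
qed simp

lemma D_pth_power [simp]: "D (y ^ p) = 0"
  by (simp add: D_power)

lemma D_constant: "c \<in> K \<Longrightarrow> D c = 0"
  using perfect by force

lemma D_minus: "D (- y) = - D y"
  using D_add[of y "- y"] by (simp add: eq_neg_iff_add_eq_0 add.commute)

lemma is_subfield_ker_D: "is_subfield {y. D y = 0}"
proof -
  have "D (inverse y) = 0" if "D y = 0" for y
  proof (cases "y = 0")
    case False
    then have "0 = D (y * inverse y)" by simp
    also have "\<dots> = y * D (inverse y)" by (simp only: D_mult that mult_zero_right add_0_right)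
    finally show ?thesis using False by simp
  qed simp
  then show ?thesis by (auto simp: is_subfield_def D_add D_mult D_minus)
qed

lemma D_poly:
  assumes "\<And>i. D (coeff f i) = 0"
  shows "D (poly f y) = poly (pderiv f) y * D y"
  using assms
proof (induction f)
  case (pCons a f)
  have "D a = 0" "\<And>i. D (coeff f i) = 0"
    using pCons.prems[of 0] pCons.prems[of "Suc _"] by simp_all
  then show ?case using pCons.IH by (simp add: D_add D_mult pderiv_pCons algebra_simps)
qed simp

text \<open>An integer is its own p-th power in F, so it passes into the p-th root. At i = p - 1 the
  value is 0: this is why exact forms are killed by the Cartier operator.\<close>

lemma p_coeff_D: "p_coeff (D y) i = of_nat (Suc i) * p_coeff y (Suc i)"
proof (cases "i < p")
  case True
  obtain r where r: "p = Suc r" using p_pos by (cases p) auto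
  then have lessThan_p: "{..<p} = insert r {..<r}" by auto
  have p_coeff_r: "p_coeff y (Suc r) = 0" by (rule p_coeff_ge) (use r in simp)
  have "D y = (\<Sum>i<r. of_nat (Suc i) * p_coeff y (Suc i) ^ p * t ^ i)"
    unfolding D_def by (subst (2) r, subst sum.lessThan_Suc_shift) simp
  also have "\<dots> = (\<Sum>i<r. (of_nat (Suc i) * p_coeff y (Suc i)) ^ p * t ^ i)"
    by (simp only: power_mult_distrib frob_of_nat)
  also have "\<dots> = (\<Sum>i<p. (of_nat (Suc i) * p_coeff y (Suc i)) ^ p * t ^ i)"
    using lessThan_p p_coeff_r by (simp add: power_0_left)
  finally show ?thesis using True by (rule p_coeff_eqI)
qed simp

text \<open>For 0 < i < p the factor i is invertible in F, so only the coordinate at t^0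
  survives.\<close>

lemma D_eq_0_imp_pth_power:
  assumes "D y = 0" shows "\<exists>a. y = a ^ p"
proof -
  have "p_coeff y i = 0" if i: "0 < i" "i < p" for i
  proof -
    have "of_nat i * p_coeff y i = 0"
      using p_coeff_D[of y "i - 1"] i assms by simp
    then show ?thesis using i of_nat_less_p_nonzero by auto
  qed
  then have "y = (\<Sum>i<p. if i = 0 then p_coeff y 0 ^ p else 0)"
    by (subst p_coeff_sum[of y], intro sum.cong) (auto simp: power_0_left)
  then show ?thesis by auto
qed

text \<open>Differentiating a relation gives a shorter one with coefficients i * f_i, up to the
  nonzero factor \<open>D x\<close>; by induction all f_i with i > 0 vanish, and then f_0
  does.\<close>

lemma power_indep_of_D_nonzero:
  assumes "D x \<noteq> 0"
  shows "n \<le> p \<Longrightarrow> (\<Sum>i<n. f i ^ p * x ^ i) = 0 \<Longrightarrow> i < n \<Longrightarrow> f i = 0"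
proof (induction n arbitrary: f i)
  case (Suc n)
  have "0 = D (\<Sum>i<Suc n. f i ^ p * x ^ i)" using Suc.prems by simp
  also have "\<dots> = (\<Sum>i<Suc n. f i ^ p * (of_nat i * x ^ (i - 1) * D x))"
    by (simp only: D_sum D_scale D_power)
  also have "\<dots> = (\<Sum>i<n. of_nat (Suc i) * f (Suc i) ^ p * x ^ i) * D x"
    unfolding sum.lessThan_Suc_shift sum_distrib_right by (simp add: mult_ac)
  also have "\<dots> = (\<Sum>i<n. (of_nat (Suc i) * f (Suc i)) ^ p * x ^ i) * D x"
    by (simp only: power_mult_distrib frob_of_nat)
  finally have "(\<Sum>i<n. (of_nat (Suc i) * f (Suc i)) ^ p * x ^ i) = 0"
    using assms by (metis mult_eq_0_iff)
  then have "of_nat (Suc i) * f (Suc i) = 0" if "i < n" for i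
    using that Suc.prems(1) by (intro Suc.IH[of "\<lambda>i. of_nat (Suc i) * f (Suc i)"]) auto
  moreover have "of_nat (Suc i) \<noteq> (0 :: 'a)" if "i < n" for i
    using that Suc.prems(1) by (intro of_nat_less_p_nonzero) auto
  ultimately have f_Suc: "f (Suc i) = 0" if "i < n" for i
    using that mult_eq_0_iff by blast
  have "f 0 ^ p = 0"
    using Suc.prems(2) f_Suc by (subst (asm) sum.lessThan_Suc_shift) (simp add: power_0_left)
  then show ?case using f_Suc Suc.prems(3) by (cases i) auto
qed simp

lemma p_basis_of_D_nonzero:
  assumes "D x \<noteq> 0" "finite_over x0"
  shows "p_basis p K x"
  using power_indep_of_D_nonzero[OF assms(1)] by (intro p_basis_of_independent[OF assms(2)]) blast

text \<open>The Cartier operator in the coordinate f of f dt; \<open>cartier_form\<close> makes the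
  connection.\<close>

definition C :: "'a \<Rightarrow> 'a" where
  "C f = p_coeff f (p - 1)"

lemma C_add: "C (f + g) = C f + C g"
  by (simp add: C_def p_coeff_add)

lemma C_scale: "C (a ^ p * f) = a * C f"
  by (simp add: C_def p_coeff_scale)

lemma C_0 [simp]: "C 0 = 0"
  by (simp add: C_def)

lemma C_sum: "C (sum f I) = (\<Sum>i\<in>I. C (f i))"
  by (induction I rule: infinite_finite_induct) (auto simp: C_add)

lemma C_of_nat_mult: "C (of_nat n * f) = of_nat n * C f"
  using C_scale[of "of_nat n" f] by (simp add: frob_of_nat)

lemma C_D [simp]: "C (D y) = 0"
  by (simp add: C_def p_coeff_D)

text \<open>Up to the factor i + 1, invertible in F, the form y^i dy is the exact form
  d(y^(i+1)).\<close>

lemma C_power_D: "Suc i < p \<Longrightarrow> C (y ^ i * D y) = 0"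
proof -
  assume i: "Suc i < p"
  have "of_nat (Suc i) * C (y ^ i * D y) = C (D (y ^ Suc i))"
    by (simp only: D_power C_of_nat_mult[symmetric]) (simp add: mult_ac)
  then have "of_nat (Suc i) * C (y ^ i * D y) = 0" by simp
  then show ?thesis using of_nat_less_p_nonzero[OF zero_less_Suc i] by (metis mult_eq_0_iff)
qed

text \<open>
  The set of all \<open>y\<close> with \<open>\<C>(y\<^sup>p\<^sup>-\<^sup>1 dy) = dy\<close> contains \<open>t\<close> and all \<open>p\<close>-th powers and is closed
  under multiplication.  It is closed under \<open>y \<mapsto> y + 1\<close>, since \<open>y\<^sup>i dy\<close> is exact for \<open>i < p - 1\<close>,
  and hence under \<open>(y, z) \<mapsto> y + z = z (y z\<^sup>p\<^sup>-\<^sup>1 z\<^sup>-\<^sup>p + 1)\<close>.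
\<close>

lemma C_power_pred_D: "C (y ^ (p - 1) * D y) = D y"
proof -
  define S where "S = {y. C (y ^ (p - 1) * D y) = D y}"
  have pow: "y ^ (p - 1) * y = y ^ p" for y :: 'a by (simp add: power_eq_if[of y p])
  have mult: "y * z \<in> S" if "y \<in> S" "z \<in> S" for y z
  proof -
    have *: "(y * z) ^ (p - 1) * D (y * z) =
        (y ^ (p - 1) * y) * (z ^ (p - 1) * D z) + (z ^ (p - 1) * z) * (y ^ (p - 1) * D y)"
      by (simp add: D_mult power_mult_distrib algebra_simps)
    have "C ((y * z) ^ (p - 1) * D (y * z)) = y * D z + z * D y"
      using that unfolding *[unfolded pow] C_add C_scale by (simp add: S_def)
    then show ?thesis by (simp add: S_def D_mult)
  qed
  have pth: "y ^ p \<in> S" for y by (simp add: S_def)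
  have "C (t ^ (p - 1) * D t) = 1" by (simp add: C_def p_coeff_power)
  then have gen: "t \<in> S" by (simp add: S_def)
  have power: "y ^ n \<in> S" if "y \<in> S" for y n
    using that pth[of 1] by (induction n) (simp_all add: mult)
  have plus1: "y + 1 \<in> S" if "y \<in> S" for y
  proof -
    obtain r where r: "p = Suc r" using p_pos by (cases p) auto
    have zero: "C (y ^ i * D y) = 0" if "i \<le> r" "i \<noteq> r" for i
      using that by (intro C_power_D) (simp add: r)
    have "(y + 1) ^ r * D y = (\<Sum>i\<le>r. of_nat (r choose i) * (y ^ i * D y))"
      by (simp add: binomial_ring sum_distrib_right mult.assoc)
    then have "C ((y + 1) ^ r * D y) = (\<Sum>i\<le>r. of_nat (r choose i) * C (y ^ i * D y))"
      by (simp add: C_sum C_of_nat_mult)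
    also have "\<dots> = (\<Sum>i\<le>r. if i = r then C (y ^ r * D y) else 0)"
      by (intro sum.cong) (auto simp: zero)
    also have "\<dots> = D y" using that by (simp add: S_def r)
    finally have "C ((y + 1) ^ (p - 1) * D (y + 1)) = D (y + 1)"
      unfolding D_add D_1 by (simp add: r)
    then show ?thesis by (simp add: S_def)
  qed
  have add: "y + z \<in> S" if "y \<in> S" "z \<in> S" for y z
  proof (cases "z = 0")
    case False
    have "y * z ^ (p - 1) * (inverse z) ^ p \<in> S"
      using that by (intro mult power pth)
    then have "z * (y * z ^ (p - 1) * (inverse z) ^ p + 1) \<in> S"
      by (rule mult[OF that(2) plus1])
    also have "z * (y * z ^ (p - 1) * (inverse z) ^ p + 1) = y * (z ^ p * inverse z ^ p) + z"
      by (simp add: algebra_simps flip: pow)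
    also have "\<dots> = y + z" using False by (simp flip: power_mult_distrib)
    finally show ?thesis .
  qed (use that in simp)
  have "0 \<in> S" by (simp add: S_def)
  then have "(\<Sum>i<n. p_coeff y i ^ p * t ^ i) \<in> S" for n
    by (induction n) (auto intro!: add mult pth power gen)
  then have "y \<in> S" by (subst p_coeff_sum[of y])
  then show ?thesis by (simp add: S_def)
qed

text \<open>Independence of the variable, in coordinates: the terms below y^(p-1) dy are exact up to
  p-th powers, which C takes out as their roots, and the last is given by
  \<open>C_power_pred_D\<close>.\<close>

lemma C_p_expansion:
  "C ((\<Sum>i<p. g i ^ p * y ^ i) * D y) = g (p - 1) * D y"
proof -
  have zero: "C (y ^ i * D y) = 0" if "i < p" "i \<noteq> p - 1" for i
    using that by (intro C_power_D) linarith
  have "C ((\<Sum>i<p. g i ^ p * y ^ i) * D y) = (\<Sum>i<p. g i * C (y ^ i * D y))"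
    by (simp add: sum_distrib_right mult.assoc C_sum C_scale)
  also have "\<dots> = (\<Sum>i<p. if i = p - 1 then g (p - 1) * C (y ^ (p - 1) * D y) else 0)"
    by (intro sum.cong) (auto simp: zero)
  finally show ?thesis using C_power_pred_D[of y] by simp
qed

end

section \<open>Valuations and residues\<close>

text \<open>Restores the convention v(0) = \<infinity>, so that estimates for sums and products need
  no exception at 0.\<close>

definition val_ge :: "('a::field \<Rightarrow> int) \<Rightarrow> int \<Rightarrow> 'a \<Rightarrow> bool" where
  "val_ge v n x \<longleftrightarrow> x = 0 \<or> n \<le> v x"

lemma val_ge_0 [simp]: "val_ge v n 0"
  by (simp add: val_ge_def)

lemma val_ge_mono: "val_ge v n x \<Longrightarrow> m \<le> n \<Longrightarrow> val_ge v m x"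
  by (auto simp: val_ge_def)

section \<open>Valuation estimates at an arbitrary place\<close>

context
  fixes K :: "'a::field set" and v :: "'a \<Rightarrow> int"
  assumes K: "is_subfield K" and v: "v \<in> places K"
begin

lemma val_mult: "x \<noteq> 0 \<Longrightarrow> y \<noteq> 0 \<Longrightarrow> v (x * y) = v x + v y"
  using v by (simp add: places_def)

lemma val_constant: "c \<in> K \<Longrightarrow> v c = 0"
  using v by (simp add: places_def)

lemma val_uniformizer: "v (uniformizer v) = 1"
  using v unfolding uniformizer_def places_def by (auto intro: someI_ex)

lemma uniformizer_nonzero: "v u = 1 \<Longrightarrow> u \<noteq> 0"
  using v by (auto simp: places_def)

lemma val_minus: "v (- x) = v x"
proof (cases "x = 0")
  case False
  have "v (- 1) = 0" by (intro val_constant subfield_closed[OF K])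
  then show ?thesis using val_mult[of "- 1" x] False by simp
qed simp

lemma val_power: "x \<noteq> 0 \<Longrightarrow> v (x ^ n) = int n * v x"
  by (induction n) (simp_all add: val_constant subfield_closed[OF K] val_mult algebra_simps)

lemma val_inverse: "x \<noteq> 0 \<Longrightarrow> v (inverse x) = - v x"
  using val_mult[of x "inverse x"] by (simp add: val_constant subfield_closed[OF K])

lemma val_powi: "x \<noteq> 0 \<Longrightarrow> v (x powi n) = n * v x"
  by (cases n rule: int_cases4) (simp_all add: power_int_minus val_inverse val_power)

lemma val_ge_minus [simp]: "val_ge v n (- x) \<longleftrightarrow> val_ge v n x"
  by (simp add: val_ge_def val_minus)

lemma val_ge_add: "val_ge v n x \<Longrightarrow> val_ge v n y \<Longrightarrow> val_ge v n (x + y)"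
proof -
  assume *: "val_ge v n x" "val_ge v n y"
  have "x \<noteq> 0 \<and> y \<noteq> 0 \<and> x + y \<noteq> 0 \<longrightarrow> min (v x) (v y) \<le> v (x + y)"
    using v by (auto simp: places_def)
  then show ?thesis using * by (auto simp: val_ge_def)
qed

lemma val_ge_diff: "val_ge v n x \<Longrightarrow> val_ge v n y \<Longrightarrow> val_ge v n (x - y)"
  using val_ge_add[of n x "- y"] by simp

lemma val_ge_sum: "(\<And>i. i \<in> I \<Longrightarrow> val_ge v n (f i)) \<Longrightarrow> val_ge v n (sum f I)"
  by (induction I rule: infinite_finite_induct) (auto intro: val_ge_add)

lemma val_ge_mult: "val_ge v m x \<Longrightarrow> val_ge v n y \<Longrightarrow> val_ge v (m + n) (x * y)"
  by (cases "x = 0"; cases "y = 0") (auto simp: val_ge_def val_mult)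

lemma val_ge_constant: "c \<in> K \<Longrightarrow> val_ge v 0 c"
  by (simp add: val_ge_def val_constant)

lemma val_ge_constant_mult: "c \<in> K \<Longrightarrow> val_ge v n x \<Longrightarrow> val_ge v n (c * x)"
  using val_ge_mult[of 0 c n x] val_ge_constant by simp

text \<open>The summands have distinct valuations, because these are distinct modulo \<open>p\<close>.\<close>

lemma val_ge_p_expansion_term:
  assumes u: "v u = 1"
    and f: "val_ge v n (\<Sum>i<p. g i ^ p * u ^ i)" and j: "j < p"
  shows "val_ge v n (g j ^ p * u ^ j)"
proof -
  define a where "a i = g i ^ p * u ^ i" for i
  define I where "I = {i. i < p \<and> g i \<noteq> 0}"
  have u0: "u \<noteq> 0" using uniformizer_nonzero[OF u] .
  have va: "v (a i) = int p * v (g i) + int i" "a i \<noteq> 0" if "i \<in> I" for i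
    using that u0 u by (auto simp: a_def I_def val_mult val_power)
  have a0: "a i = 0" if "i < p" "i \<notin> I" for i
    using that by (auto simp: I_def a_def power_0_left)
  show ?thesis
  proof (cases "j \<in> I")
    case True
    obtain i where i: "i \<in> I" and least: "\<And>i'. i' \<in> I \<Longrightarrow> v (a i) \<le> v (a i')"
    proof -
      have "finite I" "I \<noteq> {}" using True by (auto simp: I_def)
      then obtain i where "is_arg_min (\<lambda>i. v (a i)) (\<lambda>i. i \<in> I) i"
        using ex_is_arg_min_if_finite by metis
      then show ?thesis using that by (auto simp: is_arg_min_linorder)
    qed
    have "val_ge v (v (a i) + 1) (a i')" if i': "i' \<in> {..<p} - {i}" for i'
    proof (cases "i' \<in> I")
      case True
      have "v (a i) \<noteq> v (a i')"
      proof
        assume "v (a i) = v (a i')"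
        then have "(int p * v (g i) + int i) mod int p = (int p * v (g i') + int i') mod int p"
          using va(1)[OF i] va(1)[OF True] by simp
        then show False using i i' by (simp add: I_def)
      qed
      then show ?thesis using least[OF True] by (simp add: val_ge_def)
    qed (use a0 i' in simp)
    then have rest: "val_ge v (v (a i) + 1) (\<Sum>i'\<in>{..<p} - {i}. a i')"
      by (rule val_ge_sum)
    \<comment> \<open>Otherwise the least term would be the whole sum minus the other terms, all of
      larger valuation, and would have valuation larger than its own.\<close>
    have "n \<le> v (a i)"
    proof (rule ccontr)
      assume "\<not> n \<le> v (a i)"
      then have "val_ge v (v (a i) + 1) (\<Sum>i<p. a i)"
        using f by (auto simp: a_def intro: val_ge_mono)
      moreover have "(\<Sum>i<p. a i) = a i + (\<Sum>i'\<in>{..<p} - {i}. a i')"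
        using i by (intro sum.remove) (auto simp: I_def)
      ultimately have "val_ge v (v (a i) + 1) (a i)"
        using val_ge_diff[OF _ rest, of "\<Sum>i<p. a i"] by simp
      then show False using va(2)[OF i] by (simp add: val_ge_def)
    qed
    then have "n \<le> v (a j)" using least[OF True] by simp
    then show ?thesis by (simp add: val_ge_def a_def)
  next
    case False
    then have "g j = 0" using j by (simp add: I_def)
    then show ?thesis using j by (simp add: power_0_left)
  qed
qed

lemma p_expansion_independent:
  assumes u: "v u = 1" and f: "(\<Sum>i<p. g i ^ p * u ^ i) = 0" and j: "j < p"
  shows "g j = 0"
proof -
  \<comment> \<open>The sum is 0, so every bound is available; one above the term's own valuation
    forces the term to vanish.\<close>
  have "val_ge v (v (g j ^ p * u ^ j) + 1) (g j ^ p * u ^ j)"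
    by (rule val_ge_p_expansion_term[OF u _ j]) (simp add: f)
  then show ?thesis using uniformizer_nonzero[OF u] by (simp add: val_ge_def)
qed

end

lemma rational_place_is_place: "v \<in> rational_places K \<Longrightarrow> v \<in> places K"
  by (simp add: rational_places_def)

section \<open>Laurent expansions and simple poles at a rational place\<close>

context
  fixes K :: "'a::field set" and v :: "'a \<Rightarrow> int" and u :: 'a
  assumes K: "is_subfield K" and rational: "v \<in> rational_places K" and u: "v u = 1"
begin

private lemmas v = rational_place_is_place[OF rational]

text \<open>Scaling by u^(-n) makes h integral, and its residue class is represented in K because
  the place is rational.\<close>

lemma leading_coefficient_exists:
  assumes "val_ge v n h"
  shows "\<exists>c\<in>K. val_ge v (n + 1) (h - c * u powi n)"
proof (cases "h = 0")
  case True
  then show ?thesis using subfield_closed(1)[OF K] by (intro bexI[of _ 0]) auto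
next
  case False
  have u0: "u \<noteq> 0" by (rule uniformizer_nonzero[OF K v u])
  define h' where "h' = h * u powi (- n)"
  have h: "h = h' * u powi n" using u0 by (simp add: h'_def power_int_minus)
  have "0 \<le> v h'"
    using assms False u0 by (simp add: h'_def val_mult[OF K v] val_powi[OF K v] u val_ge_def)
  then obtain c where c: "c \<in> K" "h' - c = 0 \<or> 0 < v (h' - c)"
    using rational by (auto simp: rational_places_def)
  have "val_ge v (1 + n) ((h' - c) * u powi n)"
    using c u0 by (intro val_ge_mult[OF K v]) (auto simp: val_ge_def val_powi[OF K v] u)
  then show ?thesis using c(1) by (auto simp: h left_diff_distrib add.commute)
qed

lemma laurent_expansion_exists:
  assumes "val_ge v M f"
  shows "\<exists>a. laurent_expansion K v u f a"
proof -
  define c where "c h n = (SOME c. c \<in> K \<and> val_ge v (n + 1) (h - c * u powi n))" for h n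
  have c: "c h n \<in> K" "val_ge v (n + 1) (h - c h n * u powi n)" if "val_ge v n h" for h n
    using someI_ex[OF leading_coefficient_exists[OF that, unfolded Bex_def]] by (auto simp: c_def)
  \<comment> \<open>\<open>R j\<close> is what remains of f after the terms of degree below M + j
    have been removed.\<close>
  define R where "R = rec_nat f (\<lambda>j h. h - c h (M + int j) * u powi (M + int j))"
  have R_0: "R 0 = f" and R_Suc: "R (Suc j) = R j - c (R j) (M + int j) * u powi (M + int j)" for j
    by (simp_all add: R_def)
  have val_R: "val_ge v (M + int j) (R j)" for j
  proof (induction j)
    case (Suc j)
    then show ?case using c(2)[OF Suc] by (simp add: R_Suc add.assoc add.commute[of 1])
  qed (simp add: R_0 assms)
  define a where "a i = (if i < M then 0 else c (R (nat (i - M))) i)" for i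
  have R_eq: "R j = f - (\<Sum>i\<in>{M..<M + int j}. a i * u powi i)" for j
  proof (induction j)
    case (Suc j)
    have "{M..<M + int (Suc j)} = insert (M + int j) {M..<M + int j}" by auto
    then show ?case by (simp add: Suc R_Suc a_def)
  qed (simp add: R_0)
  have "laurent_expansion K v u f a"
    unfolding laurent_expansion_def
  proof (intro conjI allI exI[of _ M] impI)
    fix i show "a i \<in> K"
    proof (cases "i < M")
      case False
      then have "val_ge v i (R (nat (i - M)))" using val_R[of "nat (i - M)"] by simp
      then show ?thesis using c(1) False by (simp add: a_def)
    qed (simp add: a_def subfield_closed(1)[OF K])
    show "i < M \<Longrightarrow> a i = 0" by (simp add: a_def)
  next
    fix N
    \<comment> \<open>For N < M the truncation gives j = 0, hence an empty sum, and the bound M on f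
      itself is enough.\<close>
    define j where "j = nat (N - M + 1)"
    have "{M..N} = {M..<M + int j}" by (auto simp: j_def)
    moreover have "N < M + int j" by (simp add: j_def)
    ultimately show "let r = f - (\<Sum>i\<in>{M..N}. a i * u powi i) in r = 0 \<or> N < v r"
      using val_R[of j] by (auto simp: Let_def val_ge_def R_eq)
  qed
  then show ?thesis by blast
qed

text \<open>The expansion may start at any M, so the coefficients below -1 are first shown to vanish
  in increasing order: the first nonzero one, at i < -1, would give f valuation i.\<close>

lemma laurent_expansion_simple_pole:
  assumes a: "laurent_expansion K v u f a" and f: "val_ge v (- 1) f"
  shows "val_ge v 0 (f - a (- 1) * inverse u)"
proof -
  obtain M where aM: "\<And>i. i < M \<Longrightarrow> a i = 0"
    and r: "\<And>N. val_ge v (N + 1) (f - (\<Sum>i\<in>{M..N}. a i * u powi i))"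
    using a by (fastforce simp: laurent_expansion_def Let_def val_ge_def)
  have aK: "a i \<in> K" for i using a by (simp add: laurent_expansion_def)
  have u0: "u \<noteq> 0" by (rule uniformizer_nonzero[OF K v u])
  have sum: "(\<Sum>i\<in>{M..N}. a i * u powi i) = a N * u powi N" if "\<And>i. i < N \<Longrightarrow> a i = 0" for N
  proof (cases "M \<le> N")
    case True
    have "(\<Sum>i\<in>{M..N}. a i * u powi i) = (\<Sum>i\<in>{N}. a i * u powi i)"
      using that True by (intro sum.mono_neutral_right) auto
    then show ?thesis by simp
  qed (simp add: aM)
  have low: "i < M + int j \<Longrightarrow> i < - 1 \<Longrightarrow> a i = 0" for i j
  proof (induction j arbitrary: i)
    case (Suc j)
    show ?case
    proof (cases "i < M + int j")
      case False
      then have i: "i = M + int j" using Suc.prems by simp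
      have "a i' = 0" if "i' < i" for i' using Suc.IH that i Suc.prems by simp
      then have "val_ge v (i + 1) (f - a i * u powi i)" using r[of i] sum[of i] by simp
      moreover have "val_ge v (i + 1) f" using f Suc.prems by (auto intro: val_ge_mono)
      ultimately have "val_ge v (i + 1) (f - (f - a i * u powi i))"
        by (rule val_ge_diff[OF K v, rotated])
      then show ?thesis
        using u0 by (cases "a i = 0")
          (auto simp: val_ge_def val_mult[OF K v] val_powi[OF K v] u val_constant[OF K v aK])
    qed (use Suc in simp)
  qed (simp add: aM)
  have "a i = 0" if "i < - 1" for i
    using low[of i "nat (i - M + 1)"] that by simp
  then show ?thesis using r[of "- 1"] sum[of "- 1"] by (simp add: power_int_minus)
qed

lemma simple_pole_coefficient_unique:
  assumes "r \<in> K" "r' \<in> K" "val_ge v 0 (f - r * inverse u)" "val_ge v 0 (f - r' * inverse u)"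
  shows "r = r'"
proof (rule ccontr)
  assume "r \<noteq> r'"
  have u0: "u \<noteq> 0" by (rule uniformizer_nonzero[OF K v u])
  have "val_ge v 0 ((f - r * inverse u) - (f - r' * inverse u))"
    by (rule val_ge_diff[OF K v assms(3,4)])
  then have "val_ge v 0 ((r' - r) * inverse u)" by (simp add: algebra_simps)
  moreover have "v (r' - r) = 0" using assms subfield_diff[OF K] by (intro val_constant[OF K v]) auto
  ultimately show False
    using \<open>r \<noteq> r'\<close> u0 by (simp add: val_ge_def val_mult[OF K v] val_inverse[OF K v] u)
qed

end

text \<open>Later residue computations use this criterion in place of expansions. It serves forms
  with at most a simple pole, the only ones that occur at the points of D.\<close>

lemma residue_at_eq_iff:
  assumes K: "is_subfield K" and v: "v \<in> rational_places K"
    and f: "val_ge v (- 1) (local_coeff K v \<omega>)"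
  shows "residue_at K v \<omega> = r \<longleftrightarrow>
    r \<in> K \<and> val_ge v 0 (local_coeff K v \<omega> - r * inverse (uniformizer v))"
proof -
  note u = val_uniformizer[OF K rational_place_is_place[OF v]]
  obtain a where a: "laurent_expansion K v (uniformizer v) (local_coeff K v \<omega>) a"
    using laurent_expansion_exists[OF K v u f] by blast
  have aK: "b i \<in> K" if "laurent_expansion K v u f b" for u f b i
    using that by (simp add: laurent_expansion_def)
  have "residue_at K v \<omega> = a (- 1)"
    unfolding residue_at_def
  proof (rule the_equality)
    fix r assume "\<exists>b. laurent_expansion K v (uniformizer v) (local_coeff K v \<omega>) b \<and> r = b (- 1)"
    then show "r = a (- 1)"
      using laurent_expansion_simple_pole[OF K v u _ f] simple_pole_coefficient_unique[OF K v u] a aK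
      by metis
  qed (use a in blast)
  then show ?thesis
    using laurent_expansion_simple_pole[OF K v u a f] simple_pole_coefficient_unique[OF K v u] aK[OF a]
    by metis
qed

section \<open>Separating elements\<close>

text \<open>Division by an element of least degree. Leading terms are cancelled by monomials over k,
  which keeps the quotient over k although the polynomials live over F.\<close>

lemma principal_ideal_over_subfield:
  fixes k :: "'a::field set"
  assumes k: "is_subfield k" and I: "I \<subseteq> polys_over k"
    and diff: "\<And>f g. f \<in> I \<Longrightarrow> g \<in> I \<Longrightarrow> f - g \<in> I"
    and mult: "\<And>f g. f \<in> polys_over k \<Longrightarrow> g \<in> I \<Longrightarrow> f * g \<in> I"
    and f: "f \<in> I" "f \<noteq> 0"
  shows "\<exists>g\<in>I. g \<noteq> 0 \<and> (\<forall>h\<in>I. \<exists>s\<in>polys_over k. h = s * g)"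
proof -
  obtain g where g: "g \<in> I" "g \<noteq> 0" and least: "\<And>h. h \<in> I \<Longrightarrow> h \<noteq> 0 \<Longrightarrow> degree g \<le> degree h"
    using ex_has_least_nat[of "\<lambda>h. h \<in> I \<and> h \<noteq> 0" f degree] f by blast
  have "\<exists>s\<in>polys_over k. h = s * g" if "h \<in> I" for h
    using that
  proof (induction "degree h" arbitrary: h rule: less_induct)
    case less
    show ?case
    proof (cases "h = 0")
      case True
      then show ?thesis using polys_over_closed(1)[OF k] by (intro bexI[of _ 0]) auto
    next
      case False
      define m where "m = monom (lead_coeff h / lead_coeff g) (degree h - degree g)"
      have deg: "degree g \<le> degree h" using least less.prems False by blast
      have "coeff h i \<in> k" "coeff g i \<in> k" for i using less.prems g I by (auto simp: polys_over_def)
      then have m: "m \<in> polys_over k"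
        unfolding m_def by (intro polys_over_closed[OF k] subfield_divide[OF k])
      have r: "h - m * g \<in> I" using less.prems m g mult diff by blast
      have "m \<noteq> 0" using False g by (simp add: m_def)
      have deg_m: "degree m = degree h - degree g" "lead_coeff m = lead_coeff h / lead_coeff g"
        using False g by (simp_all add: m_def degree_monom_eq lead_coeff_monom)
      have "degree (m * g) = degree h" using deg deg_m g \<open>m \<noteq> 0\<close> by (simp add: degree_mult_eq)
      moreover have "lead_coeff (m * g) = lead_coeff h"
        unfolding lead_coeff_mult deg_m(2) using g by simp
      ultimately have "h - m * g = 0 \<or> degree (h - m * g) < degree h"
        by (metis coeff_diff degree_diff_le diff_self le_neq_implies_less leading_coeff_0_iff order_refl)
      then obtain s where "s \<in> polys_over k" "h - m * g = s * g"
        using less.hyps r polys_over_closed(1)[OF k] by (metis mult_zero_left)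
      then show ?thesis
        using m by (intro bexI[of _ "s + m"] polys_over_closed[OF k]) (simp_all add: algebra_simps)
    qed
  qed
  then show ?thesis using g by blast
qed

text \<open>A generator g of the ideal (f, f') over k has degree below that of f, so g(y) \<noteq>
  0. Then f/g vanishes at y, and minimality forces g to be constant.\<close>

lemma separable_over_of_minimal_polynomial:
  fixes k :: "'a::field set"
  assumes k: "is_subfield k"
    and f: "f \<in> polys_over k" "f \<noteq> 0" "poly f y = 0" "pderiv f \<noteq> 0"
    and least: "\<And>h. h \<in> polys_over k \<Longrightarrow> h \<noteq> 0 \<Longrightarrow> poly h y = 0 \<Longrightarrow> degree f \<le> degree h"
  shows "separable_over k y"
proof -
  note closed = polys_over_closed[OF k]
  define I where "I = {a * f + b * pderiv f | a b. a \<in> polys_over k \<and> b \<in> polys_over k}"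
  have "f \<in> I" unfolding I_def
    using closed(1,2) by (intro CollectI exI[of _ 1] exI[of _ 0]) auto
  have "pderiv f \<in> I" unfolding I_def
    using closed(1,2) by (intro CollectI exI[of _ 0] exI[of _ 1]) auto
  have sub: "I \<subseteq> polys_over k" using f(1) by (auto simp: I_def intro!: closed)
  have diff: "g - h \<in> I" if gh: "g \<in> I" "h \<in> I" for g h
  proof -
    obtain a b a' b' where "a \<in> polys_over k" "b \<in> polys_over k" "a' \<in> polys_over k" "b' \<in> polys_over k"
      "g = a * f + b * pderiv f" "h = a' * f + b' * pderiv f" using gh by (auto simp: I_def)
    then show ?thesis unfolding I_def
      by (intro CollectI exI[of _ "a - a'"] exI[of _ "b - b'"]) (simp add: closed algebra_simps)
  qed
  have mult: "g * h \<in> I" if gh: "g \<in> polys_over k" "h \<in> I" for g h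
  proof -
    obtain a b where "a \<in> polys_over k" "b \<in> polys_over k" "h = a * f + b * pderiv f"
      using gh by (auto simp: I_def)
    then show ?thesis unfolding I_def using gh
      by (intro CollectI exI[of _ "g * a"] exI[of _ "g * b"]) (simp add: closed algebra_simps)
  qed
  obtain g where g: "g \<in> I" "g \<noteq> 0" and div: "\<And>h. h \<in> I \<Longrightarrow> \<exists>s\<in>polys_over k. h = s * g"
    using principal_ideal_over_subfield[OF k sub diff mult \<open>f \<in> I\<close> f(2)] by blast
  obtain s where s: "s \<in> polys_over k" "f = s * g" using div[OF \<open>f \<in> I\<close>] by blast
  obtain s' where s': "pderiv f = s' * g" using div[OF \<open>pderiv f \<in> I\<close>] by blast
  have "g \<in> polys_over k" using g(1) \<open>I \<subseteq> polys_over k\<close> by blast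
  have "degree g \<le> degree (pderiv f)" using s' f(4) by (auto simp: degree_mult_eq)
  moreover have "degree f \<noteq> 0" using f by (metis degree_0_id pderiv_singleton)
  then have "degree (pderiv f) < degree f"
    using degree_le[of "degree f - 1" "pderiv f"]
    by (force simp: coeff_pderiv intro: coeff_eq_0)
  ultimately have "poly g y \<noteq> 0" using least[OF \<open>g \<in> polys_over k\<close> g(2)] by linarith
  then have "poly s y = 0" using f(3) s by simp
  moreover have "s \<noteq> 0" using s f(2) by auto
  ultimately have "degree f \<le> degree s" using least s(1) by blast
  then have "degree g = 0" using s(2) \<open>s \<noteq> 0\<close> g(2) by (simp add: degree_mult_eq)
  then have "g dvd 1" using g(2) by (simp add: is_unit_iff_degree)
  \<comment> \<open>Coprimality is meant over F; as g is a combination of f and f', even a common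
    divisor with coefficients in F divides the unit g.\<close>
  have "coprime f (pderiv f)"
  proof (rule coprimeI)
    fix c assume "c dvd f" "c dvd pderiv f"
    then have "c dvd g" using g(1) by (auto simp: I_def)
    then show "c dvd 1" using \<open>g dvd 1\<close> dvd_trans by blast
  qed
  then show ?thesis using f by (auto simp: separable_over_def)
qed

lemma (in perfect_constants) finite_over_imp_algebraic:
  assumes "finite_over x"
  shows "\<exists>f\<in>polys_over (adjoin K x). f \<noteq> 0 \<and> poly f y = 0"
proof -
  define k where "k = adjoin K x"
  have k: "is_subfield k" by (simp add: k_def is_subfield_adjoin[OF subfield_K])
  obtain B where B: "finite B" "\<And>y. \<exists>c. (\<forall>b\<in>B. c b \<in> k) \<and> y = (\<Sum>b\<in>B. c b * b)"
    using assms by (auto simp: finite_over_def k_def)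
  have "\<exists>d. (\<forall>i\<in>{..card B}. d i \<in> k) \<and> (\<exists>i\<in>{..card B}. d i \<noteq> 0) \<and> (\<Sum>i\<in>{..card B}. d i * y ^ i) = 0"
    by (rule more_than_spanning_dependent[OF k B(1), where e = "\<lambda>b. b"]) (use B(2) in auto)
  then obtain d i where d: "\<forall>i\<in>{..card B}. d i \<in> k" "i \<le> card B" "d i \<noteq> 0"
    "(\<Sum>i\<in>{..card B}. d i * y ^ i) = 0" by auto
  define f where "f = (\<Sum>i\<le>card B. monom (d i) i)"
  have coeff: "coeff f i = (if i \<le> card B then d i else 0)" for i
    by (simp add: f_def coeff_sum)
  have "f \<in> polys_over k" using d(1) subfield_closed(1)[OF k] by (simp add: polys_over_def coeff)
  moreover have "f \<noteq> 0" using d coeff[of i] by auto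
  moreover have "poly f y = 0" using d(4) by (simp add: f_def poly_sum poly_monom)
  ultimately show ?thesis unfolding k_def by blast
qed

lemma (in perfect_constants) finite_over_generator:
  assumes "finite_over x" "x \<in> adjoin K z"
  shows "finite_over z"
proof -
  have "adjoin K x \<subseteq> adjoin K z"
    using assms(2) by (intro adjoin_least is_subfield_adjoin subfield_subset_adjoin subfield_K)
  then show ?thesis using assms(1) unfolding finite_over_def by (meson subsetD)
qed

text \<open>Descent: among the z with F finite over K(z) and v(z) \<noteq> 0, take |v(z)| least. If
  z = w^p, then K(z) lies in K(w), so w is a competitor with |v(w)| = |v(z)|/p.\<close>

lemma (in perfect_constants) finite_over_not_pth_power:
  assumes F: "curve_function_field K" and rational: "v \<in> rational_places K"
  shows "\<exists>z. finite_over z \<and> (\<forall>w. z \<noteq> w ^ p)"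
proof -
  note v = rational_place_is_place[OF rational]
  obtain x where x: "\<not> algebraic_over K x" "finite_over x"
    using F unfolding curve_function_field_def finite_over_def by blast
  have x_shift: "x - c \<noteq> 0" if "c \<in> K" for c
  proof
    assume "x - c = 0"
    then have "poly [:- c, 1:] x = 0" by simp
    moreover have "[:- c, 1:] \<in> polys_over K"
      using that by (simp add: polys_over_closed[OF subfield_K] subfield_closed[OF subfield_K])
    ultimately show False using x(1) unfolding algebraic_over_def by (metis pCons_eq_0_iff one_neq_zero)
  qed
  have "\<exists>z. finite_over z \<and> v z \<noteq> 0"
  proof (cases "v x = 0")
    case True
    \<comment> \<open>Subtracting the residue of x leaves the generated field large enough and makes
      the valuation positive; x - c is nonzero since x is transcendental.\<close>
    then obtain c where c: "c \<in> K" "x - c = 0 \<or> 0 < v (x - c)"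
      using rational by (force simp: rational_places_def)
    have "c \<in> adjoin K (x - c)" "x - c \<in> adjoin K (x - c)"
      using c(1) subfield_subset_adjoin[OF subfield_K] generator_in_adjoin[OF subfield_K] by auto
    then have "x - c + c \<in> adjoin K (x - c)"
      by (rule subfield_closed(3)[OF is_subfield_adjoin[OF subfield_K], rotated])
    then have "finite_over (x - c)" by (intro finite_over_generator[OF x(2)]) simp
    then show ?thesis using c x_shift by force
  qed (use x in blast)
  then obtain z where z: "finite_over z" "v z \<noteq> 0"
    and least: "\<And>w. finite_over w \<Longrightarrow> v w \<noteq> 0 \<Longrightarrow> nat \<bar>v z\<bar> \<le> nat \<bar>v w\<bar>"
    using ex_has_least_nat[of "\<lambda>z. finite_over z \<and> v z \<noteq> 0" _ "\<lambda>z. nat \<bar>v z\<bar>"] by blast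
  have "z \<noteq> w ^ p" for w
  proof
    assume zw: "z = w ^ p"
    then have "w \<noteq> 0" using z(2) v by (auto simp: places_def power_0_left)
    then have vz: "v z = int p * v w" by (simp add: zw val_power[OF subfield_K v])
    have "z \<in> adjoin K w"
      unfolding zw by (intro subfield_power is_subfield_adjoin generator_in_adjoin subfield_K)
    then have "finite_over w" by (rule finite_over_generator[OF z(1)])
    moreover have "v w \<noteq> 0" using vz z(2) by auto
    ultimately have "\<bar>v z\<bar> \<le> \<bar>v w\<bar>" using least[of w] by simp
    then have "int p * \<bar>v w\<bar> \<le> 1 * \<bar>v w\<bar>" by (simp add: vz abs_mult)
    then have "int p \<le> 1" using \<open>v w \<noteq> 0\<close> by (simp only: mult_le_cancel_right)
    then show False using prime_gt_1_nat[OF prime_p] by simp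
  qed
  then show ?thesis using z(1) by blast
qed

lemma (in perfect_constants) p_basis_uniformizer:
  assumes "finite_over x" "v \<in> places K" "v u = 1"
  shows "p_basis p K u"
  by (rule p_basis_of_independent[OF assms(1)])
     (rule p_expansion_independent[OF subfield_K assms(2,3)])

context p_basis
begin

text \<open>If the minimal polynomial f of y had f' = 0, it would be a polynomial in X^p. Expanding
  its coefficients in powers of t turns f(y) = 0 into a sum of p-th powers times t^i; by
  independence each p-th root vanishes, a relation for y of lower degree.\<close>

lemma separating_generator:
  assumes "finite_over t"
  shows "separating K t"
  unfolding separating_def
proof
  fix y
  define k where "k = adjoin K t"
  have k: "is_subfield k" by (simp add: k_def is_subfield_adjoin[OF subfield_K])
  obtain f where f: "f \<in> polys_over k" "f \<noteq> 0" "poly f y = 0"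
    and least: "\<And>h. h \<in> polys_over k \<Longrightarrow> h \<noteq> 0 \<Longrightarrow> poly h y = 0 \<Longrightarrow> degree f \<le> degree h"
    using ex_has_least_nat[of "\<lambda>f. f \<in> polys_over k \<and> f \<noteq> 0 \<and> poly f y = 0" _ degree]
      finite_over_imp_algebraic[OF assms, of y] unfolding k_def by blast
  have "pderiv f \<noteq> 0"
  proof
    assume f': "pderiv f = 0"
    have coeff_0: "coeff f n = 0" if "\<not> p dvd n" for n
    proof (cases n)
      case (Suc m)
      then have "of_nat n * coeff f n = 0" using f' coeff_pderiv[of f m] by simp
      then show ?thesis using that of_nat_eq_0_iff_dvd by auto
    qed (use that in simp)
    define e where "e = degree f div p"
    have "degree f \<noteq> 0"
      using f(2,3) by (metis degree_eq_zeroE poly_pCons poly_0 add.right_neutral mult_zero_right pCons_0_0)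
    then have e: "e < degree f"
      unfolding e_def using prime_gt_1_nat[OF prime_p] by (intro div_less_dividend) auto
    \<comment> \<open>The expansion is taken inside K(t), so that the shorter relations have
      coefficients there and minimality of f applies to them.\<close>
    have "\<forall>j. \<exists>g. (\<forall>i. g i \<in> k) \<and> coeff f (p * j) = (\<Sum>i<p. g i ^ p * t ^ i)"
      using f(1) adjoin_p_decomposition unfolding polys_over_def k_def by blast
    then obtain g where g: "\<And>j i. g j i \<in> k" "\<And>j. coeff f (p * j) = (\<Sum>i<p. g j i ^ p * t ^ i)"
      by metis
    have "0 = (\<Sum>n\<le>degree f. coeff f n * y ^ n)" using f(3) by (simp add: poly_altdef)
    also have "\<dots> = (\<Sum>n\<in>(*) p ` {..e}. coeff f n * y ^ n)"
    proof (intro sum.mono_neutral_right ballI)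
      show "(*) p ` {..e} \<subseteq> {..degree f}"
      proof clarify
        fix j assume "j \<le> e"
        then have "p * j \<le> p * e" by simp
        also have "\<dots> \<le> degree f" by (simp add: e_def)
        finally show "p * j \<le> degree f" .
      qed
      fix n assume n: "n \<in> {..degree f} - (*) p ` {..e}"
      have "\<not> p dvd n"
      proof
        assume "p dvd n"
        then have "n = p * (n div p)" by simp
        moreover have "n div p \<le> e" using n by (auto simp: e_def intro: div_le_mono)
        ultimately show False using n by blast
      qed
      then show "coeff f n * y ^ n = 0" by (simp add: coeff_0)
    qed simp
    also have "\<dots> = (\<Sum>j\<le>e. coeff f (p * j) * y ^ (p * j))"
      by (subst sum.reindex) (auto simp: inj_on_def)
    also have "\<dots> = (\<Sum>j\<le>e. \<Sum>i<p. (g j i * y ^ j) ^ p * t ^ i)"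
      unfolding g(2) sum_distrib_right
      by (intro sum.cong refl) (simp add: power_mult_distrib power_mult[symmetric] mult_ac)
    also have "\<dots> = (\<Sum>i<p. (\<Sum>j\<le>e. g j i * y ^ j) ^ p * t ^ i)"
      by (subst sum.swap) (simp add: frob_sum sum_distrib_right)
    finally have sum_0: "(\<Sum>j\<le>e. g j i * y ^ j) = 0" if "i < p" for i
      using that by (intro p_indep[of "\<lambda>i. \<Sum>j\<le>e. g j i * y ^ j"]) auto
    have g_0: "g j i = 0" if "i < p" "j \<le> e" for i j
    proof -
      define h where "h = (\<Sum>j\<le>e. monom (g j i) j)"
      have coeff_h: "coeff h j = (if j \<le> e then g j i else 0)" for j
        by (simp add: h_def coeff_sum)
      have "h \<in> polys_over k"
        using g(1) subfield_closed(1)[OF k] by (simp add: polys_over_def coeff_h)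
      moreover have "poly h y = 0" using sum_0[OF that(1)] by (simp add: h_def poly_sum poly_monom)
      moreover have "degree h \<le> e" by (rule degree_le) (simp add: coeff_h)
      ultimately have "h = 0" using least[of h] e by linarith
      then show ?thesis using coeff_h[of j] that by simp
    qed
    have "lead_coeff f = 0"
    proof (cases "p dvd degree f")
      case True
      then have "degree f = p * e" by (simp add: e_def)
      moreover have "coeff f (p * e) = 0" unfolding g(2) by (simp add: g_0 power_0_left)
      ultimately show ?thesis by simp
    qed (rule coeff_0)
    then show False using f(2) by simp
  qed
  then show "separable_over (adjoin K t) y"
    unfolding k_def[symmetric] using f least by (intro separable_over_of_minimal_polynomial[OF k, of f])
qed

text \<open>If \<open>D x\<close> were 0, D would vanish on K(x), and applying D to f(t) = 0 would
  give f'(t) = 0, because \<open>D t\<close> is 1. So X - t would divide both f and f'.\<close>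

lemma D_separating:
  assumes "separating K x"
  shows "D x \<noteq> 0"
proof
  assume "D x = 0"
  then have ker: "adjoin K x \<subseteq> {y. D y = 0}"
    using D_constant by (intro adjoin_least is_subfield_ker_D) auto
  obtain f where f: "f \<in> polys_over (adjoin K x)" "coprime f (pderiv f)" "poly f t = 0"
    using assms unfolding separating_def separable_over_def by blast
  have "D (poly f t) = poly (pderiv f) t * D t"
    using f(1) ker by (intro D_poly) (auto simp: polys_over_def)
  then have "[:- t, 1:] dvd f" "[:- t, 1:] dvd pderiv f"
    using f(3) by (simp_all add: poly_eq_0_iff_dvd[symmetric])
  then have "[:- t, 1:] dvd 1" by (rule coprime_common_divisor[OF f(2)])
  then show False by (simp add: is_unit_iff_degree)
qed

text \<open>Gives meaning to the choice in \<open>separating_element\<close>. The element z from the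
  descent is used, since \<open>separating_generator\<close> needs F finite over the field generated
  by the p-basis.\<close>

lemma separating_exists:
  assumes "curve_function_field K" "v \<in> rational_places K"
  shows "\<exists>x. separating K x"
proof -
  obtain z where z: "finite_over z" "\<forall>w. z \<noteq> w ^ p" using finite_over_not_pth_power[OF assms] by blast
  then have "p_basis p K z" using D_eq_0_imp_pth_power by (intro p_basis_of_D_nonzero) auto
  then interpret z: p_basis p K z .
  show ?thesis using z.separating_generator[OF z(1)] by blast
qed

end

section \<open>Differential forms\<close>

lemma kaehler_relations_subspace: "formal.subspace (kaehler_relations K)"
  unfolding kaehler_relations_def by (rule formal.subspace_span)

lemmas kaehler_relations_closed =
  formal.subspace_0[OF kaehler_relations_subspace]
  formal.subspace_add[OF kaehler_relations_subspace]
  formal.subspace_diff[OF kaehler_relations_subspace]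
  formal.subspace_scale[OF kaehler_relations_subspace]
  formal.subspace_sum[OF kaehler_relations_subspace]

lemma kaehler_relations_generators:
  shows "Poly_Mapping.single (y + z) 1 - Poly_Mapping.single y 1 - Poly_Mapping.single z 1
      \<in> kaehler_relations K"
    and "Poly_Mapping.single (y * z) 1 - Poly_Mapping.single z y - Poly_Mapping.single y z
      \<in> kaehler_relations K"
    and "c \<in> K \<Longrightarrow> Poly_Mapping.single c 1 \<in> kaehler_relations K"
  unfolding kaehler_relations_def by (auto intro!: formal.span_base)

lemma differential_class_eq_iff:
  "differential_class K g = differential_class K h \<longleftrightarrow> g - h \<in> kaehler_relations K"
proof
  assume eq: "differential_class K g = differential_class K h"
  have "g \<in> differential_class K g"
    by (simp add: differential_class_def kaehler_relations_closed)
  then show "g - h \<in> kaehler_relations K" unfolding eq by (simp add: differential_class_def)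
next
  assume gh: "g - h \<in> kaehler_relations K"
  have "x - g \<in> kaehler_relations K \<longleftrightarrow> x - h \<in> kaehler_relations K" for x
    using kaehler_relations_closed(2)[of "x - g" K "g - h"] kaehler_relations_closed(3)[of "x - h" K "g - h"] gh
    by auto
  then show "differential_class K g = differential_class K h"
    by (simp add: differential_class_def)
qed

lemma formal_scale_single: "formal_scale c (Poly_Mapping.single y f) = Poly_Mapping.single y (c * f)"
  by (rule poly_mapping_eqI) (simp add: lookup_single when_def)

lemma single_sum: "Poly_Mapping.single y (sum f I) = (\<Sum>i\<in>I. Poly_Mapping.single y (f i))"
  by (induction I rule: infinite_finite_induct) (simp_all add: single_add)

lemma poly_mapping_eq_sum_single:
  "g = (\<Sum>y\<in>Poly_Mapping.keys g. Poly_Mapping.single y (Poly_Mapping.lookup g y))"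
  by (rule poly_mapping_eqI)
     (simp add: Poly_Mapping.lookup_sum lookup_single when_def in_keys_iff)

section \<open>Kaehler differentials as a one-dimensional F-space with basis dt\<close>

context p_basis
begin

text \<open>The F-linear extension of dy \<mapsto> \<open>D y\<close>. It kills the relations
  because D is a derivation trivial on K, whence f dt determines f.\<close>

definition coordinate :: "('a \<Rightarrow>\<^sub>0 'a) \<Rightarrow> 'a" where
  "coordinate g = (\<Sum>y\<in>Poly_Mapping.keys g. Poly_Mapping.lookup g y * D y)"

lemma coordinate_superset:
  "finite A \<Longrightarrow> Poly_Mapping.keys g \<subseteq> A \<Longrightarrow> coordinate g = (\<Sum>y\<in>A. Poly_Mapping.lookup g y * D y)"
  unfolding coordinate_def by (rule sum.mono_neutral_left) (auto simp: in_keys_iff)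

lemma coordinate_add: "coordinate (g + h) = coordinate g + coordinate h"
proof -
  define A where "A = Poly_Mapping.keys g \<union> Poly_Mapping.keys h"
  have "finite A" "Poly_Mapping.keys (g + h) \<subseteq> A" "Poly_Mapping.keys g \<subseteq> A" "Poly_Mapping.keys h \<subseteq> A"
    using Poly_Mapping.keys_add[of g h] by (auto simp: A_def)
  then show ?thesis
    by (simp add: coordinate_superset[of A] lookup_add distrib_right sum.distrib)
qed

lemma coordinate_scale: "coordinate (formal_scale c g) = c * coordinate g"
proof -
  have "Poly_Mapping.keys (formal_scale c g) \<subseteq> Poly_Mapping.keys g"
    by (auto simp: in_keys_iff)
  then have "coordinate (formal_scale c g) =
      (\<Sum>y\<in>Poly_Mapping.keys g. Poly_Mapping.lookup (formal_scale c g) y * D y)"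
    by (intro coordinate_superset) auto
  then show ?thesis by (simp add: coordinate_def sum_distrib_left mult.assoc)
qed

lemma coordinate_single [simp]: "coordinate (Poly_Mapping.single y f) = f * D y"
  by (subst coordinate_superset[of "{y}"]) auto

lemma coordinate_0 [simp]: "coordinate 0 = 0"
  by (simp add: coordinate_def)

lemma coordinate_diff: "coordinate (g - h) = coordinate g - coordinate h"
  using coordinate_add[of "g - h" h] by simp

lemma coordinate_relation: "g \<in> kaehler_relations K \<Longrightarrow> coordinate g = 0"
proof -
  have "kaehler_relations K \<subseteq> {g. coordinate g = 0}"
    unfolding kaehler_relations_def
    by (rule formal.span_minimal)
       (auto simp: coordinate_diff D_add D_mult D_constant formal.subspace_def coordinate_add coordinate_scale)
  then show "g \<in> kaehler_relations K \<Longrightarrow> coordinate g = 0" by blast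
qed

text \<open>The y with this property contain t and all p-th powers and are closed under sums and
  products, hence are all of F by the expansion in powers of t.\<close>

lemma dy_eq_D_dt: "Poly_Mapping.single y 1 - Poly_Mapping.single t (D y) \<in> kaehler_relations K"
proof -
  let ?s = Poly_Mapping.single
  define \<delta> where "\<delta> y = ?s y 1 - ?s t (D y)" for y
  define S where "S = {y. \<delta> y \<in> kaehler_relations K}"
  have scale_\<delta>: "formal_scale a (\<delta> y) = ?s y a - ?s t (a * D y)" for a y
    by (simp add: \<delta>_def formal.scale_right_diff_distrib formal_scale_single)
  have add: "y + z \<in> S" if "y \<in> S" "z \<in> S" for y z
  proof -
    have "\<delta> (y + z) = (?s (y + z) 1 - ?s y 1 - ?s z 1) + (\<delta> y + \<delta> z)"
      by (simp add: \<delta>_def D_add single_add)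
    then show ?thesis using that unfolding S_def
      by (auto intro!: kaehler_relations_closed(2) kaehler_relations_generators)
  qed
  have mult: "y * z \<in> S" if "y \<in> S" "z \<in> S" for y z
  proof -
    have "\<delta> (y * z) = (?s (y * z) 1 - ?s z y - ?s y z) +
        (formal_scale y (\<delta> z) + formal_scale z (\<delta> y))"
      unfolding scale_\<delta> by (simp add: \<delta>_def D_mult single_add)
    then show ?thesis using that unfolding S_def
      by (auto intro!: kaehler_relations_closed kaehler_relations_generators)
  qed
  have const: "c \<in> S" if "c \<in> K" for c
    using that by (simp add: S_def \<delta>_def D_constant kaehler_relations_generators)
  have gen: "t \<in> S" by (simp add: S_def \<delta>_def kaehler_relations_closed)
  \<comment> \<open>Needed at n = p, where it says d(y^p) = 0.\<close>
  have power_rule: "?s (y ^ n) 1 - ?s y (of_nat n * y ^ (n - 1)) \<in> kaehler_relations K" for y n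
  proof (induction n)
    case 0
    then show ?case using subfield_closed(2)[OF subfield_K] by (simp add: kaehler_relations_generators)
  next
    case (Suc n)
    have "?s (y ^ Suc n) 1 - ?s y (of_nat (Suc n) * y ^ (Suc n - 1)) =
        (?s (y * y ^ n) 1 - ?s (y ^ n) y - ?s y (y ^ n)) +
        formal_scale y (?s (y ^ n) 1 - ?s y (of_nat n * y ^ (n - 1)))"
      by (cases n; rule poly_mapping_eqI)
         (simp_all add: lookup_add lookup_minus lookup_single when_def algebra_simps)
    then show ?case using Suc
      by (auto intro!: kaehler_relations_closed kaehler_relations_generators simp del: power_Suc)
  qed
  have pth: "y ^ p \<in> S" for y using power_rule[of y p] by (simp add: S_def \<delta>_def)
  have power: "y ^ n \<in> S" if "y \<in> S" for y n
    using that const[OF subfield_closed(2)[OF subfield_K]] by (induction n) (simp_all add: mult)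
  have "0 \<in> S" using const[OF subfield_closed(1)[OF subfield_K]] .
  then have "(\<Sum>i<n. p_coeff y i ^ p * t ^ i) \<in> S" for n
    by (induction n) (auto intro!: add mult pth power gen)
  then have "y \<in> S" by (subst p_coeff_sum[of y])
  then show ?thesis by (simp add: S_def \<delta>_def)
qed

lemma form_change_variable: "form K f y = form K (f * D y) t"
proof -
  have "formal_scale f (Poly_Mapping.single y 1 - Poly_Mapping.single t (D y)) \<in> kaehler_relations K"
    by (intro kaehler_relations_closed dy_eq_D_dt)
  then show ?thesis
    by (simp add: form_def differential_class_eq_iff formal.scale_right_diff_distrib formal_scale_single)
qed

lemma form_eq_iff [simp]: "form K f t = form K g t \<longleftrightarrow> f = g"
proof
  assume "form K f t = form K g t"
  then have "coordinate (Poly_Mapping.single t f - Poly_Mapping.single t g) = 0"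
    by (intro coordinate_relation) (simp add: form_def differential_class_eq_iff)
  then show "f = g" by (simp add: coordinate_diff)
qed simp

lemma differential_class_eq_form: "differential_class K g = form K (coordinate g) t"
proof -
  have "(\<Sum>y\<in>Poly_Mapping.keys g. formal_scale (Poly_Mapping.lookup g y)
      (Poly_Mapping.single y 1 - Poly_Mapping.single t (D y))) \<in> kaehler_relations K"
    by (intro kaehler_relations_closed dy_eq_D_dt)
  moreover have "g - Poly_Mapping.single t (coordinate g) =
      (\<Sum>y\<in>Poly_Mapping.keys g. formal_scale (Poly_Mapping.lookup g y)
        (Poly_Mapping.single y 1 - Poly_Mapping.single t (D y)))"
    apply (simp add: formal.scale_right_diff_distrib formal_scale_single sum_subtractf
        flip: poly_mapping_eq_sum_single)
    by (simp add: coordinate_def single_sum)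
  ultimately show ?thesis by (simp add: form_def differential_class_eq_iff)
qed

lemma differentials_eq: "differentials K = range (\<lambda>f. form K f t)"
proof
  show "differentials K \<subseteq> range (\<lambda>f. form K f t)"
    unfolding differentials_def by (auto simp: differential_class_eq_form)
  show "range (\<lambda>f. form K f t) \<subseteq> differentials K"
    unfolding differentials_def form_def by blast
qed

end

text \<open>Finiteness turns every y with \<open>D y \<noteq> 0\<close> into a p-basis; the other
  assumption makes the chosen separating element usable.\<close>

locale curve = p_basis p K t for p :: nat and K :: "'a::field set" and t :: 'a +
  assumes finite_over_exists: "\<exists>x. finite_over x"
    and separating: "separating K (separating_element K)"
begin

text \<open>By \<open>C_p_expansion\<close>, every expansion in the separating element leads to the
  same form, so the definite description in \<open>cartier\<close> is justified.\<close>

lemma cartier_form: "cartier K p (form K f t) = form K (C f) t"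
proof -
  define x where "x = separating_element K"
  have Dx: "D x \<noteq> 0" using D_separating[OF separating] by (simp add: x_def)
  then interpret x: p_basis p K x using finite_over_exists p_basis_of_D_nonzero by blast
  \<comment> \<open>The coefficient of dx in f dt is f / \<open>D x\<close>.\<close>
  obtain g where "f / D x = (\<Sum>i<p. g i ^ p * x ^ i)" using x.p_span by blast
  then have g: "f = (\<Sum>i<p. g i ^ p * x ^ i) * D x" using Dx by (simp add: field_simps)
  show ?thesis
    unfolding cartier_def Let_def x_def[symmetric]
  proof (rule the_equality)
    show "\<exists>g. form K f t = form K (\<Sum>i<p. g i ^ p * x ^ i) x \<and> form K (C f) t = form K (g (p - 1)) x"
      using C_p_expansion[of g x] g by (intro exI[of _ g]) (simp add: form_change_variable[of _ x])
  next
    fix \<eta> assume "\<exists>g. form K f t = form K (\<Sum>i<p. g i ^ p * x ^ i) x \<and> \<eta> = form K (g (p - 1)) x"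
    then obtain g where "f = (\<Sum>i<p. g i ^ p * x ^ i) * D x" "\<eta> = form K (g (p - 1) * D x) t"
      by (auto simp: form_change_variable[of _ x])
    then show "\<eta> = form K (C f) t" using C_p_expansion[of g x] by simp
  qed
qed

lemma cartier_iter_form: "cartier_iter K p m (form K f t) = form K ((C ^^ m) f) t"
  unfolding cartier_iter_def by (induction m) (simp_all add: cartier_form)

text \<open>The coefficient of f dt with respect to du, for the chosen uniformizer u at v.\<close>

definition loc :: "('a \<Rightarrow> int) \<Rightarrow> 'a \<Rightarrow> 'a" where
  "loc v f = f / D (uniformizer v)"

lemma loc_add: "loc v (f + g) = loc v f + loc v g"
  and loc_diff: "loc v (f - g) = loc v f - loc v g"
  and loc_mult: "loc v (h * f) = h * loc v f"
  by (simp_all add: loc_def add_divide_distrib diff_divide_distrib)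

lemma loc_0 [simp]: "loc v 0 = 0"
  by (simp add: loc_def)

context
  fixes v :: "'a \<Rightarrow> int"
  assumes v: "v \<in> places K"
begin

text \<open>Its valuation 1 is not divisible by p, so it is not a p-th power.\<close>

lemma D_uniformizer: "D (uniformizer v) \<noteq> 0"
proof
  assume "D (uniformizer v) = 0"
  then obtain a where a: "uniformizer v = a ^ p" using D_eq_0_imp_pth_power by blast
  note u = val_uniformizer[OF subfield_K v]
  have "a \<noteq> 0" using a uniformizer_nonzero[OF subfield_K v u] by (auto simp: power_0_left)
  then have "int p * v a = 1" using u by (simp add: a val_power[OF subfield_K v])
  then have "int p = 1" by (simp add: zmult_eq_1_iff)
  then show False using prime_gt_1_nat[OF prime_p] by simp
qed

lemma local_coeff_form: "local_coeff K v (form K f t) = loc v f"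
  unfolding local_coeff_def form_change_variable[of _ "uniformizer v"] form_eq_iff loc_def
  using D_uniformizer by (intro the_equality) (auto simp: field_simps)

lemma loc_eq_0_iff [simp]: "loc v f = 0 \<longleftrightarrow> f = 0"
  using D_uniformizer by (simp add: loc_def)

text \<open>In the expansion in powers of u, C returns g = g_(p-1), and g^p u^(p-1) obeys the same
  bound as the whole sum. So p v(g) + p - 1 >= p n, and integrality gives v(g) >= n. Iterated, this
  is the origin of the condition G >= q G_1.\<close>

lemma val_ge_C:
  assumes "val_ge v (int p * n) (loc v f)"
  shows "val_ge v n (loc v (C f))"
proof -
  define u where "u = uniformizer v"
  have u: "v u = 1" unfolding u_def by (rule val_uniformizer[OF subfield_K v])
  have u0: "u \<noteq> 0" by (rule uniformizer_nonzero[OF subfield_K v u])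
  have Du: "D u \<noteq> 0" unfolding u_def by (rule D_uniformizer)
  then interpret u: p_basis p K u using finite_over_exists p_basis_of_D_nonzero by blast
  obtain g where g: "loc v f = (\<Sum>i<p. g i ^ p * u ^ i)" using u.p_span by blast
  then have "f = (\<Sum>i<p. g i ^ p * u ^ i) * D u" using Du by (simp add: loc_def u_def[symmetric] field_simps)
  then have Cf: "loc v (C f) = g (p - 1)" using C_p_expansion[of g u] Du by (simp add: loc_def u_def)
  have "val_ge v (int p * n) (g (p - 1) ^ p * u ^ (p - 1))"
    by (rule val_ge_p_expansion_term[OF subfield_K v u]) (use assms g in auto)
  then have "int p * n \<le> int p * v (g (p - 1)) + int (p - 1)" if "g (p - 1) \<noteq> 0"
    using that u0 by (simp add: val_ge_def val_mult[OF subfield_K v] val_power[OF subfield_K v] u)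
  moreover have "int p * v (g (p - 1)) + int (p - 1) < int p * (v (g (p - 1)) + 1)"
    using p_pos by (simp add: distrib_left of_nat_diff)
  ultimately have "n < v (g (p - 1)) + 1" if "g (p - 1) \<noteq> 0"
    using that p_pos by (smt (verit) mult_le_cancel_left_pos of_nat_0_less_iff)
  then show ?thesis by (auto simp: Cf val_ge_def)
qed

lemma val_ge_C_iterate:
  "val_ge v (int p ^ m * n) (loc v f) \<Longrightarrow> val_ge v n (loc v ((C ^^ m) f))"
proof (induction m arbitrary: n)
  case (Suc m)
  then have "val_ge v (int p * n) (loc v ((C ^^ m) f))" by (intro Suc.IH) (simp add: mult_ac)
  then show ?case by (simp add: val_ge_C)
qed simp

text \<open>The case n = -1 of \<open>val_ge_C\<close>, which tolerates poles up to order p.\<close>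

lemma simple_pole_C: "val_ge v (- 1) (loc v f) \<Longrightarrow> val_ge v (- 1) (loc v (C f))"
  by (rule val_ge_C, erule val_ge_mono) (use p_pos in linarith)

lemma simple_pole_C_iterate: "val_ge v (- 1) (loc v f) \<Longrightarrow> val_ge v (- 1) (loc v ((C ^^ m) f))"
  by (induction m) (simp_all add: simple_pole_C)

end

lemma residue_form_eq_iff:
  assumes "v \<in> rational_places K" "val_ge v (- 1) (loc v f)"
  shows "residue_at K v (form K f t) = r \<longleftrightarrow>
    r \<in> K \<and> val_ge v 0 (loc v f - r * inverse (uniformizer v))"
  using residue_at_eq_iff[OF subfield_K assms(1), of "form K f t"] assms
  by (simp add: local_coeff_form rational_place_is_place)

text \<open>With r = s^p, the polar part r/u du equals (s/u)^p u^(p-1) du and is sent to s/u du. The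
  remainder is regular and stays regular by \<open>val_ge_C\<close> with n = 0.\<close>

lemma residue_C:
  assumes v: "v \<in> rational_places K" and f: "val_ge v (- 1) (loc v f)"
  shows "residue_at K v (form K (C f) t) ^ p = residue_at K v (form K f t)"
proof -
  note pl = rational_place_is_place[OF v]
  define u where "u = uniformizer v"
  have u0: "u \<noteq> 0"
    unfolding u_def by (rule uniformizer_nonzero[OF subfield_K pl val_uniformizer[OF subfield_K pl]])
  define r where "r = residue_at K v (form K f t)"
  have r: "r \<in> K" "val_ge v 0 (loc v f - r * inverse u)"
    using residue_form_eq_iff[OF v f, of r] by (simp_all add: r_def u_def)
  obtain s where s: "s \<in> K" "r = s ^ p" using perfect[OF r(1)] by blast
  have up: "u ^ p = u ^ (p - 1) * u" by (simp add: power_eq_if[of u p])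
  have "r * inverse u = (s * inverse u) ^ p * u ^ (p - 1)"
    unfolding power_mult_distrib power_inverse up using u0 s by (simp add: field_simps)
  then have C_polar: "C (r * inverse u * D u) = s * inverse u * D u"
    using C_scale[of "s * inverse u" "u ^ (p - 1) * D u"] C_power_pred_D[of u] by (simp add: mult.assoc)
  have C_eq: "C (f - r * inverse u * D u) = C f - s * inverse u * D u"
    using C_add[of "f - r * inverse u * D u" "r * inverse u * D u"] C_polar by simp
  have loc_u: "loc v (c * D u) = c" for c using D_uniformizer[OF pl] by (simp add: loc_def u_def)
  have "val_ge v (int p * 0) (loc v (f - r * inverse u * D u))"
    using r(2) by (simp add: loc_diff loc_u)
  from val_ge_C[OF pl this] have "val_ge v 0 (loc v (C f) - s * inverse u)"
    by (simp add: C_eq loc_diff loc_u)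
  then have "residue_at K v (form K (C f) t) = s"
    using residue_form_eq_iff[OF v simple_pole_C[OF pl f]] s(1) by (simp add: u_def)
  then show ?thesis using s(2) by (simp add: r_def)
qed

lemma residue_C_iterate:
  assumes v: "v \<in> rational_places K" and f: "val_ge v (- 1) (loc v f)"
  shows "residue_at K v (form K ((C ^^ m) f) t) ^ (p ^ m) = residue_at K v (form K f t)"
proof (induction m)
  case (Suc m)
  note residue_C[OF v simple_pole_C_iterate[OF rational_place_is_place[OF v] f]]
  then show ?case using Suc by (simp add: power_mult)
qed simp

lemma Omega_eq:
  "Omega K A = (\<lambda>f. form K f t) ` {f. \<forall>v\<in>places K. val_ge v (A v) (loc v f)}"
proof -
  have zero: "differential_class K 0 = form K 0 t" by (simp add: form_def)
  have "form K f t = differential_class K 0 \<or> A v \<le> ord_form K v (form K f t) \<longleftrightarrow>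
      val_ge v (A v) (loc v f)" if "v \<in> places K" for f v
    using that unfolding zero form_eq_iff by (simp add: ord_form_def local_coeff_form val_ge_def)
  then show ?thesis unfolding Omega_def differentials_eq by auto
qed

end

section \<open>Codes\<close>

text \<open>Multiplication by c \<noteq> 0 permutes the nonzero elements of k; comparing products
  gives the claim.\<close>

lemma finite_subfield_power_card:
  fixes k :: "'a::field set"
  assumes k: "is_subfield k" and fin: "finite k" and c: "c \<in> k"
  shows "c ^ card k = c"
proof (cases "c = 0")
  case True
  then show ?thesis using fin c by (auto simp: power_0_left)
next
  case False
  define k' where "k' = k - {0}"
  have card_k: "card k = Suc (card k')"
    using card_Suc_Diff1[OF fin subfield_closed(1)[OF k]] by (simp add: k'_def)
  have "(*) c ` k' = k'"
  proof (rule endo_inj_surj)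
    show "(*) c ` k' \<subseteq> k'" using False c by (auto simp: k'_def intro: subfield_closed[OF k])
  qed (use False fin in \<open>auto simp: k'_def inj_on_def\<close>)
  then have "prod id k' = prod id ((*) c ` k')" by simp
  also have "\<dots> = (\<Prod>x\<in>k'. c * x)"
    using False by (subst prod.reindex) (auto simp: inj_on_def)
  also have "\<dots> = c ^ card k' * prod id k'" by (simp add: prod.distrib)
  finally have "c ^ card k' = 1" using fin by (simp add: k'_def)
  then show ?thesis by (simp add: card_k)
qed

text \<open>The polynomial X^|k| - X has at most |k| roots in F, and k already supplies that
  many.\<close>

lemma finite_subfield_eq_roots:
  fixes k :: "'a::field set"
  assumes k: "is_subfield k" and fin: "finite k" and x: "x ^ card k = x"
  shows "x \<in> k"
proof -
  define f :: "'a poly" where "f = monom 1 (card k) - monom 1 1"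
  have "card {0, 1 :: 'a} \<le> card k"
    using subfield_closed(1,2)[OF k] fin by (intro card_mono) auto
  then have card_k: "1 < card k" by simp
  then have "coeff f (card k) = 1" by (simp add: f_def)
  then have "f \<noteq> 0" by auto
  have roots: "{y. poly f y = 0} = {y. y ^ card k = y}" by (auto simp: f_def poly_monom)
  have "degree f \<le> card k"
    unfolding f_def using card_k by (intro degree_diff_le degree_monom_le order_trans[OF degree_monom_le]) auto
  then have "card {y. poly f y = 0} \<le> card k"
    using card_poly_roots_bound[OF \<open>f \<noteq> 0\<close>] by linarith
  moreover have "k \<subseteq> {y. poly f y = 0}"
    unfolding roots using finite_subfield_power_card[OF k fin] by blast
  ultimately have "k = {y. poly f y = 0}"
    using poly_roots_finite[OF \<open>f \<noteq> 0\<close>] by (intro card_seteq) auto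
  then show ?thesis using x roots by blast
qed

text \<open>Translation by 1 permutes K, so comparing sums over K gives |K| = 0 in F and hence p =
  0. A p-th root of c is c^(p^(n-1)).\<close>

lemma perfect_constants_of_finite:
  fixes K :: "'a::field set"
  assumes p: "prime p" and K: "is_subfield K" and card_K: "card K = p ^ n" and n: "0 < n"
  shows "perfect_constants p K"
proof
  have fin: "finite K" using card_K p by (intro card_ge_0_finite) (simp add: prime_gt_0_nat)
  have "(\<lambda>x. x + 1) ` K = K"
    by (rule endo_inj_surj) (use fin in \<open>auto simp: inj_on_def intro: subfield_closed[OF K]\<close>)
  then have "(\<Sum>x\<in>K. x) = (\<Sum>x\<in>(\<lambda>x. x + 1) ` K. x)" by simp
  also have "\<dots> = (\<Sum>x\<in>K. x + 1)" by (subst sum.reindex) auto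
  finally have "of_nat (card K) = (0 :: 'a)" by (simp add: sum.distrib)
  then show "of_nat p = (0 :: 'a)" by (simp add: card_K)
  fix c assume c: "c \<in> K"
  have "c = c ^ (p ^ n)" using finite_subfield_power_card[OF K fin c] card_K by simp
  also have "\<dots> = (c ^ (p ^ (n - 1))) ^ p"
    using n by (simp add: power_mult[symmetric] power_eq_if[of p n] mult.commute)
  finally show "\<exists>a\<in>K. c = a ^ p" using subfield_power[OF K c] by blast
qed (use assms in auto)

text \<open>A largest independent subset spans modulo W: adding v creates a relation in which v has
  a nonzero coefficient, and the relation is solved for v.\<close>

lemma (in vector_space) basis_mod_exists:
  assumes k: "is_subfield k" and V: "finite V"
    and W: "0 \<in> W" "\<And>a w. a \<in> k \<Longrightarrow> w \<in> W \<Longrightarrow> scale a w \<in> W"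
  shows "\<exists>B. basis_mod k scale V W B"
proof -
  define ind where "ind B \<longleftrightarrow> B \<subseteq> V \<and>
     (\<forall>c. (\<forall>b\<in>B. c b \<in> k) \<and> (\<Sum>b\<in>B. scale (c b) b) \<in> W \<longrightarrow> (\<forall>b\<in>B. c b = 0))" for B
  have "ind {}" by (simp add: ind_def)
  moreover have "\<forall>B. ind B \<longrightarrow> card B < Suc (card V)"
    using V by (auto simp: ind_def less_Suc_eq_le intro: card_mono)
  ultimately obtain B where B: "ind B" and greatest: "\<And>B'. ind B' \<Longrightarrow> card B' \<le> card B"
    using ex_has_greatest_nat[of ind "{}" card] by blast
  have fin: "finite B" using B V finite_subset by (auto simp: ind_def)
  have "\<exists>c. (\<forall>b\<in>B. c b \<in> k) \<and> v - (\<Sum>b\<in>B. scale (c b) b) \<in> W" if v: "v \<in> V" for v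
  proof (cases "v \<in> B")
    case True
    have "(\<Sum>b\<in>B. scale (if b = v then 1 else 0) b) = (\<Sum>b\<in>B. if b = v then v else 0)"
      by (intro sum.cong) auto
    then have "v - (\<Sum>b\<in>B. scale (if b = v then 1 else 0) b) \<in> W" using True fin W(1) by simp
    then show ?thesis using subfield_closed(1,2)[OF k] by (intro exI[of _ "\<lambda>b. if b = v then 1 else 0"]) auto
  next
    case False
    then have "\<not> ind (insert v B)" using greatest[of "insert v B"] fin by auto
    then obtain c where c: "\<forall>b\<in>insert v B. c b \<in> k" "(\<Sum>b\<in>insert v B. scale (c b) b) \<in> W"
      "\<exists>b\<in>insert v B. c b \<noteq> 0"
    proof -
      have "insert v B \<subseteq> V" using v B by (simp add: ind_def)
      with \<open>\<not> ind (insert v B)\<close> show ?thesis using that unfolding ind_def by metis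
    qed
    have sum: "(\<Sum>b\<in>insert v B. scale (c b) b) = scale (c v) v + (\<Sum>b\<in>B. scale (c b) b)"
      using False fin by simp
    have cv: "c v \<noteq> 0"
    proof
      assume "c v = 0"
      then have "(\<forall>b\<in>B. c b \<in> k) \<and> (\<Sum>b\<in>B. scale (c b) b) \<in> W" using c(1,2) sum by simp
      then have "\<forall>b\<in>B. c b = 0" using B unfolding ind_def by blast
      then show False using c(3) \<open>c v = 0\<close> by auto
    qed
    have "scale (inverse (c v)) (scale (c v) v + (\<Sum>b\<in>B. scale (c b) b)) \<in> W"
      using c(1,2) sum by (intro W(2) subfield_closed[OF k]) auto
    also have "scale (inverse (c v)) (scale (c v) v + (\<Sum>b\<in>B. scale (c b) b)) =
        v - (\<Sum>b\<in>B. scale (- (inverse (c v) * c b)) b)"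
      using cv by (simp add: scale_right_distrib scale_sum_right sum_negf)
    finally show ?thesis using c(1)
      by (intro exI[of _ "\<lambda>b. - (inverse (c v) * c b)"]) (auto intro!: subfield_closed[OF k])
  qed
  then show ?thesis
    unfolding basis_mod_def using B[unfolded ind_def] fin by (intro exI[of _ B] conjI ballI) (assumption | elim conjE bspec)+
qed

text \<open>A finite infimum comes from a nonempty set and is attained there.\<close>

lemma quotient_dim_eq_enat:
  assumes "quotient_dim k s V W = enat n"
  obtains B where "basis_mod k s V W B" "card B = n"
proof -
  define A where "A = {enat (card B) | B. basis_mod k s V W B}"
  have Inf_A: "Inf A = enat n" using assms by (simp add: quotient_dim_def A_def)
  then have "A \<noteq> {}" by (auto simp: Inf_enat_def)
  then have "Inf A \<in> A" unfolding Inf_enat_def by (auto intro: LeastI)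
  then obtain B where "basis_mod k s V W B" "card B = n" unfolding Inf_A by (auto simp: A_def)
  then show ?thesis by (rule that)
qed

section \<open>Comparison of the two codes through C_q - 1\<close>

locale cartier_code_setting = curve p K t
  for p :: nat and K :: "'a::field set" and t :: 'a +
  fixes m :: nat and k :: "'a set" and P :: "'n::finite \<Rightarrow> 'a \<Rightarrow> int" and G G1 :: "'a divisor"
  assumes finite_K: "finite K"
    and subfield_k: "is_subfield k" and k_K: "k \<subseteq> K" and card_k: "card k = p ^ m"
    and inj_P: "inj P" and rational_P: "P i \<in> rational_places K"
    and G_P: "G (P i) = 0" and G_ge_mult: "int (p ^ m) * G1 v \<le> G v" and G_ge: "G1 v \<le> G v"
begin

text \<open>Not a Riemann-Roch space of functions: these are the coordinates f of the forms f dt in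
  \<Omega>(A).\<close>

definition L :: "'a divisor \<Rightarrow> 'a set" where
  "L A = {f. \<forall>v\<in>places K. val_ge v (A v) (loc v f)}"

definition res :: "'a \<Rightarrow> 'a ^ 'n" where
  "res f = residue_vector K P (form K f t)"

abbreviation L_poles :: "'a set" where
  "L_poles \<equiv> L (\<lambda>v. G v - sum_of_points P v)"

definition rational_residues :: "'a set" where
  "rational_residues = {f \<in> L_poles. \<forall>i. res f $ i \<in> k}"

definition T :: "'a \<Rightarrow> 'a" where
  "T f = (C ^^ m) f - f"

lemma finite_k: "finite k"
  using finite_subset[OF k_K finite_K] .

lemma place_P: "P i \<in> places K"
  using rational_P by (rule rational_place_is_place)

lemma L_zero: "0 \<in> L A"
  by (simp add: L_def)

lemma L_add: "f \<in> L A \<Longrightarrow> g \<in> L A \<Longrightarrow> f + g \<in> L A"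
  by (auto simp: L_def loc_add intro: val_ge_add[OF subfield_K])

lemma L_scale: "c \<in> K \<Longrightarrow> f \<in> L A \<Longrightarrow> c * f \<in> L A"
  by (auto simp: L_def loc_mult intro: val_ge_constant_mult[OF subfield_K])

lemma AG_code_eq: "AG_code K P G = res ` L_poles"
  unfolding AG_code_def Omega_eq L_def res_def image_image by simp

lemma subfield_subcode_eq: "subfield_subcode k (AG_code K P G) = res ` rational_residues"
  by (auto simp: subfield_subcode_def AG_code_eq rational_residues_def)

lemma cartier_code_eq: "cartier_code K p m P G = res ` {f \<in> L_poles. T f = 0}"
proof -
  have "{\<omega> \<in> Omega K (\<lambda>v. G v - sum_of_points P v). cartier_iter K p m \<omega> = \<omega>} =
      (\<lambda>f. form K f t) ` {f \<in> L_poles. T f = 0}"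
    by (auto simp: Omega_eq L_def cartier_iter_form T_def)
  then show ?thesis unfolding cartier_code_def res_def by (simp add: image_image)
qed

lemma sum_of_points_at: "sum_of_points P (P i) = 1"
proof -
  have "sum_of_points P (P i) = (\<Sum>j\<in>UNIV. if j = i then 1 else 0)"
    unfolding sum_of_points_def by (intro sum.cong) (auto dest: injD[OF inj_P])
  then show ?thesis by simp
qed

lemma sum_of_points_off: "v \<notin> range P \<Longrightarrow> sum_of_points P v = 0"
  unfolding sum_of_points_def by (intro sum.neutral) auto

lemma simple_pole_at_P: "f \<in> L_poles \<Longrightarrow> val_ge (P i) (- 1) (loc (P i) f)"
  using place_P[of i] G_P[of i] sum_of_points_at[of i] by (auto simp: L_def dest: bspec[of _ _ "P i"])

lemma res_eq_iff:
  assumes "f \<in> L_poles"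
  shows "res f = c \<longleftrightarrow>
    (\<forall>i. c $ i \<in> K \<and> val_ge (P i) 0 (loc (P i) f - c $ i * inverse (uniformizer (P i))))"
  using residue_form_eq_iff[OF rational_P simple_pole_at_P[OF assms]]
  by (simp add: res_def residue_vector_def vec_eq_iff)

lemma res_in_K: "f \<in> L_poles \<Longrightarrow> res f $ i \<in> K"
  and val_ge_res: "f \<in> L_poles \<Longrightarrow>
    val_ge (P i) 0 (loc (P i) f - res f $ i * inverse (uniformizer (P i)))"
  using res_eq_iff by blast+

lemma res_add:
  assumes "f \<in> L_poles" "g \<in> L_poles" shows "res (f + g) = res f + res g"
  unfolding res_eq_iff[OF L_add[OF assms]]
  using val_ge_add[OF subfield_K place_P val_ge_res[OF assms(1)] val_ge_res[OF assms(2)]]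
  by (auto simp: loc_add algebra_simps res_in_K assms intro: subfield_closed[OF subfield_K])

lemma res_scale:
  assumes "c \<in> K" "f \<in> L_poles" shows "res (c * f) = c *s res f"
  unfolding res_eq_iff[OF L_scale[OF assms]]
  using val_ge_constant_mult[OF subfield_K place_P assms(1) val_ge_res[OF assms(2)]]
  by (auto simp: loc_mult algebra_simps res_in_K assms intro: subfield_closed[OF subfield_K])

lemma res_0: "res 0 = 0"
  using res_scale[OF subfield_closed(1)[OF subfield_K] L_zero] by simp

lemma L_sum:
  "(\<And>b. b \<in> B \<Longrightarrow> c b \<in> K) \<Longrightarrow> (\<And>b. b \<in> B \<Longrightarrow> f b \<in> L A) \<Longrightarrow> (\<Sum>b\<in>B. c b * f b) \<in> L A"
  by (induction B rule: infinite_finite_induct) (auto intro: L_zero L_add L_scale)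

lemma res_sum:
  "(\<And>b. b \<in> B \<Longrightarrow> c b \<in> K) \<Longrightarrow> (\<And>b. b \<in> B \<Longrightarrow> f b \<in> L_poles) \<Longrightarrow>
    res (\<Sum>b\<in>B. c b * f b) = (\<Sum>b\<in>B. c b *s res (f b))"
  by (induction B rule: infinite_finite_induct)
     (simp_all add: res_0 res_add res_scale L_scale L_sum)

lemma C_iterate_add: "(C ^^ n) (f + g) = (C ^^ n) f + (C ^^ n) g"
  by (induction n) (simp_all add: C_add)

lemma C_iterate_scale: "(C ^^ n) (a ^ (p ^ n) * f) = a * (C ^^ n) f"
proof (induction n arbitrary: a)
  case (Suc n)
  have "(C ^^ n) (a ^ (p ^ Suc n) * f) = a ^ p * (C ^^ n) f"
    using Suc.IH[of "a ^ p"] by (simp add: power_mult[symmetric])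
  then show ?case by (simp add: C_scale)
qed simp

lemma T_add: "T (f + g) = T f + T g"
  by (simp add: T_def C_iterate_add)

text \<open>C_q is linear only up to q-th roots, C_q(c^q f) = c C_q(f), and c^q = c for c in
  k.\<close>

lemma T_scale: "c \<in> k \<Longrightarrow> T (c * f) = c * T f"
  using C_iterate_scale[of m c f] finite_subfield_power_card[OF subfield_k finite_k, of c] card_k
  by (simp add: T_def right_diff_distrib)

lemma T_0: "T 0 = 0"
  using T_scale[OF subfield_closed(1)[OF subfield_k], of 0] by simp

lemma T_diff: "T (f - g) = T f - T g"
  using T_add[of "f - g" g] by simp

lemma residue_C_iterate_eq:
  assumes "f \<in> L_poles"
  shows "residue_at K (P i) (form K ((C ^^ m) f) t) ^ (p ^ m) = res f $ i"
  using residue_C_iterate[OF rational_P simple_pole_at_P[OF assms]]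
  by (simp add: res_def residue_vector_def)

text \<open>The residue of C_q(\<omega>) is the q-th root of that of \<omega>, so a fixed form has
  residues with r^q = r, that is, in k.\<close>

lemma fixed_rational_residues:
  assumes "f \<in> L_poles" "T f = 0"
  shows "f \<in> rational_residues"
proof -
  have "res f $ i ^ card k = res f $ i" for i
    using residue_C_iterate_eq[OF assms(1), of i] assms(2)
    by (simp add: T_def card_k res_def residue_vector_def)
  then show ?thesis
    using finite_subfield_eq_roots[OF subfield_k finite_k] assms(1) by (simp add: rational_residues_def)
qed

lemma frob_iterate_inj: "(x :: 'a) ^ (p ^ n) = y ^ (p ^ n) \<Longrightarrow> x = y"
  by (induction n) (simp_all add: power_mult mult.commute[of p] frob_inj)

text \<open>At a point of D both forms have at most simple poles with equal residues, since r^q = r,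
  so the poles cancel. Elsewhere G >= q G_1 controls C_q(\<omega>) and G >= G_1 controls
  \<omega>.\<close>

lemma T_in_L:
  assumes f: "f \<in> rational_residues"
  shows "T f \<in> L G1"
  unfolding L_def
proof (intro CollectI ballI)
  fix v assume v: "v \<in> places K"
  have fL: "f \<in> L_poles" and fk: "\<And>i. res f $ i \<in> k" using f by (auto simp: rational_residues_def)
  show "val_ge v (G1 v) (loc v (T f))"
  proof (cases "v \<in> range P")
    case True
    then obtain i where i: "v = P i" by blast
    define r where "r = res f $ i"
    \<comment> \<open>At this point G is 0, so G_1 is nonpositive there and regularity of the
      difference suffices.\<close>
    have "int (p ^ m) * G1 v \<le> 0" using G_ge_mult[of v] G_P[of i] i by simp
    moreover have "0 < int (p ^ m)" by simp
    ultimately have G1: "G1 v \<le> 0" by (simp only: mult_le_0_iff) linarith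
    have "residue_at K v (form K ((C ^^ m) f) t) ^ (p ^ m) = r ^ (p ^ m)"
      using residue_C_iterate_eq[OF fL, of i] finite_subfield_power_card[OF subfield_k finite_k fk[of i]]
      by (simp add: i r_def card_k)
    then have "residue_at K v (form K ((C ^^ m) f) t) = r" by (rule frob_iterate_inj)
    then have "val_ge v 0 (loc v ((C ^^ m) f) - r * inverse (uniformizer v))"
      using residue_form_eq_iff[OF rational_P simple_pole_C_iterate[OF place_P simple_pole_at_P[OF fL]]]
      by (simp add: i)
    moreover have "val_ge v 0 (loc v f - r * inverse (uniformizer v))"
      using val_ge_res[OF fL] by (simp add: i r_def)
    ultimately have "val_ge v 0 ((loc v ((C ^^ m) f) - r * inverse (uniformizer v)) -
        (loc v f - r * inverse (uniformizer v)))"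
      by (rule val_ge_diff[OF subfield_K v])
    then have "val_ge v 0 (loc v (T f))" by (simp add: T_def loc_diff)
    then show ?thesis using G1 by (rule val_ge_mono)
  next
    case False
    then have fG: "val_ge v (G v) (loc v f)"
      using fL v sum_of_points_off[OF False] by (auto simp: L_def)
    have "val_ge v (int p ^ m * G1 v) (loc v f)"
      using val_ge_mono[OF fG G_ge_mult] by simp
    then have "val_ge v (G1 v) (loc v ((C ^^ m) f))" by (rule val_ge_C_iterate[OF v])
    then show ?thesis
      unfolding T_def loc_diff using val_ge_mono[OF fG G_ge] by (rule val_ge_diff[OF subfield_K v])
  qed
qed

lemma cartier_code_subset: "cartier_code K p m P G \<subseteq> subfield_subcode k (AG_code K P G)"
  unfolding cartier_code_eq subfield_subcode_eq using fixed_rational_residues by blast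

text \<open>Every form in \<Omega>(G_1) is a K-combination of the h basis representatives, and there
  are |K|^h choices of coefficients.\<close>

lemma card_L_le:
  assumes "h1 K G1 = enat h"
  shows "finite (L G1)" "card (L G1) \<le> card K ^ h"
proof -
  obtain B where B: "basis_mod K formal_scale (\<Union> (Omega K G1)) (kaehler_relations K) B" "card B = h"
    using assms unfolding h1_def by (rule quotient_dim_eq_enat)
  have finB: "finite B" using B(1) by (simp add: basis_mod_def)
  define Fs where "Fs = B \<rightarrow>\<^sub>E K"
  have finFs: "finite Fs" and card_Fs: "card Fs = card K ^ h"
    unfolding Fs_def using finB finite_K B(2) by (simp_all add: finite_PiE card_PiE)
  have sub: "(\<lambda>f. form K f t) ` L G1 \<subseteq> (\<lambda>c. differential_class K (\<Sum>b\<in>B. formal_scale (c b) b)) ` Fs"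
  proof
    fix \<omega> assume "\<omega> \<in> (\<lambda>f. form K f t) ` L G1"
    then obtain f where f: "f \<in> L G1" "\<omega> = form K f t" by blast
    have "form K f t \<in> Omega K G1" using f(1) by (auto simp: Omega_eq L_def)
    \<comment> \<open>\<open>h1\<close> speaks of formal sums, so the basis is applied to a
      representative of the form.\<close>
    moreover have "Poly_Mapping.single t f \<in> form K f t"
      by (simp add: form_def differential_class_def kaehler_relations_closed)
    ultimately obtain c where c: "\<forall>b\<in>B. c b \<in> K"
      "Poly_Mapping.single t f - (\<Sum>b\<in>B. formal_scale (c b) b) \<in> kaehler_relations K"
      using B(1) unfolding basis_mod_def by blast
    have "(\<Sum>b\<in>B. formal_scale (restrict c B b) b) = (\<Sum>b\<in>B. formal_scale (c b) b)"
      by (intro sum.cong) auto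
    then have "\<omega> = differential_class K (\<Sum>b\<in>B. formal_scale (restrict c B b) b)"
      using c(2) by (simp add: f(2) form_def differential_class_eq_iff)
    moreover have "restrict c B \<in> Fs" using c(1) by (auto simp: Fs_def)
    ultimately show "\<omega> \<in> (\<lambda>c. differential_class K (\<Sum>b\<in>B. formal_scale (c b) b)) ` Fs" by blast
  qed
  have inj: "inj_on (\<lambda>f. form K f t) (L G1)" by (auto simp: inj_on_def)
  show "finite (L G1)"
    using finite_imageD[OF finite_subset[OF sub finite_imageI[OF finFs]] inj] .
  have "card (L G1) = card ((\<lambda>f. form K f t) ` L G1)" by (simp add: card_image[OF inj])
  also have "\<dots> \<le> card ((\<lambda>c. differential_class K (\<Sum>b\<in>B. formal_scale (c b) b)) ` Fs)"
    by (rule card_mono[OF finite_imageI[OF finFs] sub])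
  also have "\<dots> \<le> card K ^ h" using card_image_le[OF finFs] card_Fs by metis
  finally show "card (L G1) \<le> card K ^ h" .
qed

text \<open>
  Lifting a basis \<open>B\<close> modulo the Cartier code to differential forms and applying \<open>\<C>\<^sub>q - 1\<close>
  embeds \<open>k\<^sup>B\<close> into \<open>\<Omega>(G\<^sub>1)\<close>.
\<close>

lemma card_basis_le:
  assumes B: "basis_mod k (*s) (subfield_subcode k (AG_code K P G)) (cartier_code K p m P G) B"
    and fin: "finite (L G1)"
  shows "card k ^ card B \<le> card (L G1)"
proof -
  have finB: "finite B" and BV: "B \<subseteq> res ` rational_residues"
    and indep: "\<And>c. \<forall>b\<in>B. c b \<in> k \<Longrightarrow> (\<Sum>b\<in>B. c b *s b) \<in> cartier_code K p m P G \<Longrightarrow> \<forall>b\<in>B. c b = 0"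
    using B unfolding basis_mod_def subfield_subcode_eq by blast+
  have "\<forall>b\<in>B. \<exists>f. f \<in> rational_residues \<and> res f = b" using BV by blast
  then obtain \<phi> where \<phi>: "\<And>b. b \<in> B \<Longrightarrow> \<phi> b \<in> rational_residues" "\<And>b. b \<in> B \<Longrightarrow> res (\<phi> b) = b"
    by metis
  define S where "S c = (\<Sum>b\<in>B. c b * \<phi> b)" for c
  have S_L: "S c \<in> L_poles" and res_S: "res (S c) = (\<Sum>b\<in>B. c b *s b)" if "\<forall>b\<in>B. c b \<in> k" for c
  proof -
    have c: "\<And>b. b \<in> B \<Longrightarrow> c b \<in> K" using that k_K by blast
    have \<phi>L: "\<And>b. b \<in> B \<Longrightarrow> \<phi> b \<in> L_poles" using \<phi>(1) by (auto simp: rational_residues_def)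
    show "S c \<in> L_poles" unfolding S_def using c \<phi>L by (rule L_sum)
    have "res (S c) = (\<Sum>b\<in>B. c b *s res (\<phi> b))"
      unfolding S_def using c \<phi>L by (rule res_sum)
    also have "\<dots> = (\<Sum>b\<in>B. c b *s b)" by (intro sum.cong) (simp_all add: \<phi>(2))
    finally show "res (S c) = (\<Sum>b\<in>B. c b *s b)" .
  qed
  have "inj_on (\<lambda>c. T (S c)) (B \<rightarrow>\<^sub>E k)"
  proof (rule inj_onI)
    fix c d assume c: "c \<in> B \<rightarrow>\<^sub>E k" and d: "d \<in> B \<rightarrow>\<^sub>E k" and eq: "T (S c) = T (S d)"
    define e where "e b = c b - d b" for b
    have e: "\<forall>b\<in>B. e b \<in> k" using c d unfolding e_def by (auto intro!: subfield_diff[OF subfield_k])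
    have "S e = S c - S d" by (simp add: S_def e_def left_diff_distrib sum_subtractf)
    then have "T (S e) = 0" using eq by (simp add: T_diff)
    \<comment> \<open>Forms killed by \<open>T\<close> are fixed by C_q, so their residue vectors
      are Cartier codewords and independence of \<open>B\<close> applies.\<close>
    then have "res (S e) \<in> cartier_code K p m P G"
      unfolding cartier_code_eq using S_L[OF e] by blast
    then have "\<forall>b\<in>B. e b = 0" using indep[OF e] res_S[OF e] by simp
    then show "c = d" using c d by (intro PiE_ext) (auto simp: e_def)
  qed
  moreover have "(\<lambda>c. T (S c)) ` (B \<rightarrow>\<^sub>E k) \<subseteq> L G1"
  proof clarify
    fix c assume "c \<in> B \<rightarrow>\<^sub>E k"
    then have c: "\<forall>b\<in>B. c b \<in> k" by auto
    have "res (S c) $ i \<in> k" for i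
      unfolding res_S[OF c] using c \<phi>
      by (auto simp: rational_residues_def sum_component intro!: subfield_sum[OF subfield_k] subfield_closed[OF subfield_k])
    then show "T (S c) \<in> L G1" using S_L[OF c] by (intro T_in_L) (simp add: rational_residues_def)
  qed
  ultimately have "card (B \<rightarrow>\<^sub>E k) \<le> card (L G1)" using fin by (rule card_inj_on_le)
  then show ?thesis using finB by (simp add: card_PiE)
qed

lemma finite_subfield_subcode: "finite (subfield_subcode k (AG_code K P G))"
proof -
  have "subfield_subcode k (AG_code K P G) \<subseteq> vec_lambda ` (UNIV \<rightarrow>\<^sub>E k)"
  proof
    fix c assume "c \<in> subfield_subcode k (AG_code K P G)"
    then have "vec_nth c \<in> UNIV \<rightarrow>\<^sub>E k" by (auto simp: subfield_subcode_def)
    then have "vec_lambda (vec_nth c) \<in> vec_lambda ` (UNIV \<rightarrow>\<^sub>E k)" by (rule imageI)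
    then show "c \<in> vec_lambda ` (UNIV \<rightarrow>\<^sub>E k)" by simp
  qed
  then show ?thesis by (rule finite_subset) (simp add: finite_PiE finite_k)
qed

text \<open>Comparing exponents in q^|B| <= q^(l h) is possible because q > 1, and the size of any
  one basis bounds the infimum.\<close>

lemma quotient_dim_le:
  assumes h: "h1 K G1 = enat h" and card_K: "card K = (p ^ m) ^ l" and m: "1 \<le> m"
  shows "quotient_dim k (*s) (subfield_subcode k (AG_code K P G)) (cartier_code K p m P G) \<le> enat (l * h)"
proof -
  have zero: "0 \<in> cartier_code K p m P G"
    unfolding cartier_code_eq by (rule image_eqI[of _ _ 0]) (simp_all add: res_0 L_zero T_0)
  have scale: "c *s w \<in> cartier_code K p m P G" if cw: "c \<in> k" "w \<in> cartier_code K p m P G" for c w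
  proof -
    obtain f where f: "f \<in> L_poles" "T f = 0" "w = res f" using cw(2) unfolding cartier_code_eq by blast
    have "c * f \<in> L_poles" "T (c * f) = 0" "c *s w = res (c * f)"
      using cw(1) k_K f by (auto simp: T_scale res_scale subsetD intro!: L_scale)
    then show ?thesis unfolding cartier_code_eq by blast
  qed
  obtain B where B: "basis_mod k (*s) (subfield_subcode k (AG_code K P G)) (cartier_code K p m P G) B"
    using vec.basis_mod_exists[OF subfield_k finite_subfield_subcode zero scale] by blast
  have "card k ^ card B \<le> card K ^ h"
    using card_basis_le[OF B card_L_le(1)[OF h]] card_L_le(2)[OF h] by linarith
  then have "(p ^ m) ^ card B \<le> (p ^ m) ^ (l * h)" by (simp add: card_k card_K power_mult)
  moreover have "1 < p ^ m" using prime_gt_1_nat[OF prime_p] m by (intro one_less_power) auto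
  ultimately have "card B \<le> l * h" using power_le_imp_le_exp by blast
  moreover have "quotient_dim k (*s) (subfield_subcode k (AG_code K P G)) (cartier_code K p m P G)
      \<le> enat (card B)"
    unfolding quotient_dim_def using B by (intro Inf_lower) blast
  ultimately show ?thesis using enat_ord_simps(1) order_trans by blast
qed

text \<open>Here \<Omega>(G_1) is zero, so C_q fixes every form whose residues lie in k.\<close>

lemma codes_eq:
  assumes "h1 K G1 = 0"
  shows "subfield_subcode k (AG_code K P G) = cartier_code K p m P G"
proof -
  have "card (L G1) \<le> 1" "finite (L G1)"
    using card_L_le[of 0] assms by (simp_all add: zero_enat_def)
  then have "L G1 = {0}" using L_zero[of G1] by (metis card_le_Suc0_iff_eq One_nat_def insertI1 is_singletonI' is_singleton_def singletonD empty_iff)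
  then have "T f = 0" if "f \<in> rational_residues" for f using T_in_L[OF that] by simp
  then have "subfield_subcode k (AG_code K P G) \<subseteq> cartier_code K p m P G"
    unfolding cartier_code_eq subfield_subcode_eq by (auto simp: rational_residues_def)
  then show ?thesis using cartier_code_subset by blast
qed

end

theorem theorem5p1:
  fixes p m q l :: nat
    and k K :: "'a::field set"
    and P :: "'n::finite \<Rightarrow> 'a \<Rightarrow> int"
    and G G1 :: "'a divisor"
  assumes "prime p" and "m \<ge> 1" and "q = p ^ m" and "l \<ge> 1"
    and "curve_function_field K" and "card K = q ^ l"
    and "is_subfield k" and "k \<subseteq> K" and "card k = q"
    and "inj P" and "\<And>i. P i \<in> rational_places K"
    and "is_divisor K G" and "\<And>i. G (P i) = 0"
    and "is_divisor K G1" and "(\<lambda>v. int q * G1 v) \<le> G" and "G1 \<le> G"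
  shows "quotient_dim k (*s) (subfield_subcode k (AG_code K P G)) (cartier_code K p m P G)
           \<le> enat l * h1 K G1
    \<and> (h1 K G1 = 0 \<longrightarrow> subfield_subcode k (AG_code K P G) = cartier_code K p m P G)"
proof -
  have K: "is_subfield K" using assms(5) by (simp add: curve_function_field_def)
  have card_K: "card K = (p ^ m) ^ l" using assms(3,6) by simp
  interpret perfect_constants p K
    by (rule perfect_constants_of_finite[OF assms(1) K, of "m * l"])
       (use card_K assms(2,4) in \<open>simp_all add: power_mult\<close>)
  obtain x where x: "finite_over x"
    using assms(5) unfolding curve_function_field_def finite_over_def by blast
  \<comment> \<open>The index type is nonempty, so a rational point is available; any one will
    do.\<close>
  define v0 where "v0 = P undefined"
  have v0: "v0 \<in> rational_places K" using assms(11) by (simp add: v0_def)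
  define t where "t = uniformizer v0"
  have "p_basis p K t"
    unfolding t_def using rational_place_is_place[OF v0]
    by (intro p_basis_uniformizer[OF x] val_uniformizer[OF K])
  then interpret p_basis p K t .
  have "\<exists>x. separating K x" using separating_exists[OF assms(5) v0] .
  then have sep: "separating K (separating_element K)"
    unfolding separating_element_def by (rule someI_ex)
  interpret cartier_code_setting p K t m k P G G1
  proof unfold_locales
    show "\<exists>x. finite_over x" using x by blast
    show "finite K" using card_K p_pos by (intro card_ge_0_finite) simp
  qed (use assms sep in \<open>auto simp: le_fun_def\<close>)
  show ?thesis
  proof (cases "h1 K G1")
    case (enat h)
    then show ?thesis using quotient_dim_le[OF enat card_K assms(2)] codes_eq by simp
  next
    case infinity
    \<comment> \<open>Here l \<noteq> 0 matters, as 0 times \<infinity> is 0 in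
      \<open>enat\<close>.\<close>
    then have "enat l * h1 K G1 = \<infinity>" using assms(4) by (simp add: imult_is_infinity)
    then show ?thesis using codes_eq by simp
  qed
qed

end
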